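(* Let $\mathcal X\subset\mathbb R^M$ be a connected open set and let $H_1\in C^1(\mathcal X,\operatorname{Sym}(N))$ be non-degenerate, with connected aggregate interaction graph $G(\mathcal A(\mathbf x;H_1))$ for every $\mathbf x\in\mathcal X$. Let $K\subset\mathcal X$ be compact and rectifiably path-connected with path-length bound $L_K<\infty$, i.e. any two points of $K$ can be joined by a rectifiable path in $K$ of length at most $L_K$. Let $T(\mathbf x)$ be spanning trees of $G(\mathcal A(\mathbf x;H_1))$ and $\ell(\mathbf x)$ admissible active direction labels for $H_1$ such that, for some constant $\kappa_K>0$, $$\bigl|\mathcal A^{\ell_e(\mathbf x)}_{e}(\mathbf x;H_1)\bigr|\ge\kappa_K\qquad\text{for all }\mathbf x\in K\text{ and all edges } e\text{ of }T(\mathbf x).$$ Then there exist constants $C,\delta_0>0$ such that, if $H_2\in C^1(\mathcal X,\operatorname{Sym}(N))$ and $\Delta_K(H_1,H_2)\le\delta_0$, then $$\operatorname{dist}_K(H_1,H_2)\le C\,\Delta_K(H_1,H_2).$$ The constants $C,\delta_0$ depend on $H_1,H_2$ only through $g_K,B_K,\kappa_K,L_K,N,M$.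
   Context: $N,M\ge 1$ are integers. $\operatorname{Sym}(N)$, $\operatorname{Skew}(N)$, $\mathsf O(N)$ denote the real symmetric, real skew-symmetric and real orthogonal $N\times N$ matrices. $\lambda_1(\mathbf x;H)\le\dots\le\lambda_N(\mathbf x;H)$ are the ordered eigenvalues of $H(\mathbf x)$. A family $H$ is non-degenerate (on a set) if $H(\mathbf x)$ has $N$ distinct eigenvalues for every $\mathbf x$ in that set. Derivative couplings. For $H\in C^1(\mathcal X,\operatorname{Sym}(N))$ and a point $\mathbf x$ at which $H(\mathbf x)$ has distinct eigenvalues, there is an ordered $C^1$ eigenframe near $\mathbf x$: $\mathbf u=(u_1,\dots,u_N)$, $C^1$ with values in $\mathsf O(N)$, $\mathbf u^\top H\mathbf u=\operatorname{diag}(\lambda_1,\dots,\lambda_N)$, $\lambda_1<\dots<\lambda_N$. A pointwise derivative coupling of $H$ is any choice, at each such $\mathbf x$, of $\mathcal A^\mu(\mathbf x;H)=\mathbf u(\mathbf x)^\top\partial_{x_\mu}\mathbf u(\mathbf x)\in\operatorname{Skew}(N)$, $\mu=1,\dots,M$, for such a frame $\mathbf u$. It is unique up to $\mathcal A^\mu(\mathbf x;H)\mapsto S(\mathbf x)\mathcal A^\mu(\mathbf x;H)S(\mathbf x)$ with $S(\mathbf x)$ diagonal with $\pm1$ entries, independent of $\mu$; all quantities below are independent of this choice. For an edge $e=\{m,n\}$, $|\mathcal A^\mu_e|:=|\mathcal A^\mu_{mn}|$. Interaction graph. $G(\mathcal A(\mathbf x;H))$ is the graph on vertices $\{1,\dots,N\}$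 with edges $\{m,n\}$, $m\neq n$, such that $\mathcal A^\mu_{mn}(\mathbf x;H)\ne0$ for at least one $\mu$. Let $E(\mathbf x)$ be the edge set of $G(\mathcal A(\mathbf x;H_1))$. Admissible active direction labels assign to each $\mathbf x$ and $e=\{m,n\}\in E(\mathbf x)$ a label $\ell_e(\mathbf x)\in\{1,\dots,M\}$ with $\mathcal A^{\ell_e(\mathbf x)}_{mn}(\mathbf x;H_1)\neq0$. Moduli of $H_1$ on $K$: $g_K:=\inf_{\mathbf x\in K}\min_{m\ne n}|\lambda_m(\mathbf x;H_1)-\lambda_n(\mathbf x;H_1)|>0$ and $B_K:=\sup_{\mathbf x\in K}\|H_1(\mathbf x)\|_F+\max_{\mu}\sup_{\mathbf x\in K}\|\mathcal A^\mu(\mathbf x;H_1)\|_F<\infty$. Invariant map. For $H\in C^1(\mathcal X,\operatorname{Sym}(N))$ (with index sets $E(\mathbf x),T(\mathbf x),\ell(\mathbf x)$ always taken from the reference $H_1$), $\mathfrak P_{T,\ell}(\mathbf x;H)$ is the collection of: (1) the eigenvalues $\lambda_n(\mathbf x;H)$, $n=1,\dots,N$; (2) the pure 2-loops $\mathcal A^\mu_{mn}(\mathbf x;H)^2$ for all $1\le m<n\le N$, $\mu=1,\dots,M$; (3) the mixed 2-loops $\mathcal A^{\ell_e(\mathbf x)}_{mn}(\mathbf x;H)\,\mathcal A^\mu_{mn}(\mathbf x;H)$ for all $e=\{m,n\}\in E(\mathbf x)$, $\mu\in\{1,\dots,M\}\setminus\{\ell_e(\mathbf x)\}$; (4) the extended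 cycle products: for every vertex pair $\{p,q\}$, $p<q$, that is not an edge of $T(\mathbf x)$ (whether or not $\{p,q\}\in E(\mathbf x)$) and every $\mu=1,\dots,M$, with $p=v_0,\dots,v_k=q$ the unique path in $T(\mathbf x)$ and $f_r=\{v_{r-1},v_r\}$, the number $\Big(\prod_{r=1}^k\mathcal A^{\ell_{f_r}(\mathbf x)}_{v_{r-1}v_r}(\mathbf x;H)\Big)\mathcal A^{\mu}_{qp}(\mathbf x;H)$. Distances. $\operatorname{dist}_K(H_1,H_2):=\inf_{Q_0\in\mathsf O(N)}\sup_{\mathbf x\in K}\|H_2(\mathbf x)-Q_0^\top H_1(\mathbf x)Q_0\|_F$, and $\Delta_K(H_1,H_2):=\sup_{\mathbf x\in K}\|\mathfrak P_{T,\ell}(\mathbf x;H_1)-\mathfrak P_{T,\ell}(\mathbf x;H_2)\|_\infty$, where $\|\cdot\|_\infty$ is the maximum absolute value of the components. Convention: if $H_2(\mathbf x)$ has a repeated eigenvalue at some $\mathbf x\in K$ (so that the components (2)–(4) are not defined there), set $\Delta_K(H_1,H_2)=+\infty$. *)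

theory Defs
  imports "HOL-Analysis.Analysis"
begin

text \<open>
  Conventions. The index set of rows, columns and graph vertices is a finite linearly ordered
  type \<^typ>\<open>'n\<close> with \<open>N = CARD('n)\<close>, and \<open>M = CARD('m)\<close> for the type \<^typ>\<open>'m\<close>
  of coordinate directions.  On \<^typ>\<open>real^'n^'n\<close>, \<^const>\<open>norm\<close> is the Frobenius norm, and
  \<^term>\<open>A $ i $ j\<close> is the entry in row \<open>i\<close> and column \<open>j\<close>.
\<close>

type_synonym 'n sq_matrix = "real^'n^'n"

section \<open>Matrix families and derivative couplings\<close>

definition diag_matrix :: "real^'n \<Rightarrow> real^'n^'n" where
  "diag_matrix v = (\<chi> i j. if i = j then v $ i else 0)"

text \<open>
  The roots of the characteristic polynomial, with multiplicity, in nondecreasing order.  The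
  description is uniquely satisfiable when all roots are real, in particular for symmetric \<open>A\<close>.
\<close>
definition ordered_eigenvalues :: "'n sq_matrix \<Rightarrow> (real, 'n::{finite,linorder}) vec" where
  "ordered_eigenvalues A =
     (THE v. mono (\<lambda>i. v $ i) \<and> (\<forall>z. det (mat z - A) = (\<Prod>i\<in>UNIV. z - v $ i)))"

definition eigenvalue_set :: "('n::finite) sq_matrix \<Rightarrow> real set" where
  "eigenvalue_set A = {z. \<exists>v. v \<noteq> 0 \<and> A *v v = z *\<^sub>R v}"

definition has_distinct_eigenvalues :: "('n::finite) sq_matrix \<Rightarrow> bool" where
  "has_distinct_eigenvalues A \<longleftrightarrow> card (eigenvalue_set A) = CARD('n)"

definition nondegenerate_on :: "'a set \<Rightarrow> ('a \<Rightarrow> ('n::finite) sq_matrix) \<Rightarrow> bool" where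
  "nondegenerate_on S H \<longleftrightarrow> (\<forall>x\<in>S. has_distinct_eigenvalues (H x))"

definition C1_on :: "'a::real_normed_vector set \<Rightarrow> ('a \<Rightarrow> 'b::real_normed_vector) \<Rightarrow> bool" where
  "C1_on U f \<longleftrightarrow> (\<exists>f'. (\<forall>x\<in>U. (f has_derivative blinfun_apply (f' x)) (at x)) \<and>
                      continuous_on U f')"

definition C1_symmetric_family :: "(real^'m) set \<Rightarrow> (real^'m \<Rightarrow> ('n::finite) sq_matrix) \<Rightarrow> bool" where
  "C1_symmetric_family X H \<longleftrightarrow> C1_on X H \<and> (\<forall>x\<in>X. transpose (H x) = H x)"

definition partial_deriv :: "'m \<Rightarrow> (real^'m \<Rightarrow> 'b::real_normed_vector) \<Rightarrow> real^'m \<Rightarrow> 'b" where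
  "partial_deriv \<mu> f x = frechet_derivative f (at x) (axis \<mu> 1)"

definition C1_eigenframe_on ::
  "(real^'m) set \<Rightarrow> (real^'m \<Rightarrow> 'n sq_matrix) \<Rightarrow> (real^'m \<Rightarrow> ('n::{finite,linorder}) sq_matrix) \<Rightarrow> bool"
where
  "C1_eigenframe_on U H u \<longleftrightarrow> C1_on U u \<and>
     (\<forall>y\<in>U. orthogonal_matrix (u y) \<and>
        transpose (u y) ** H y ** u y = diag_matrix (ordered_eigenvalues (H y)) \<and>
        strict_mono (\<lambda>i. ordered_eigenvalues (H y) $ i))"

text \<open>
  \<open>A x \<mu>\<close> is the coupling matrix at \<open>x\<close> in direction \<open>\<mu>\<close>; one frame \<open>u\<close> serves all \<open>\<mu>\<close>.  This is a
  predicate because the coupling is only determined up to a choice of signs at each point.  Values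
  of \<open>A\<close> at points where \<open>H x\<close> has a repeated eigenvalue are unconstrained.
\<close>
definition derivative_coupling ::
  "(real^'m) set \<Rightarrow> (real^'m \<Rightarrow> 'n sq_matrix) \<Rightarrow>
   (real^'m \<Rightarrow> 'm \<Rightarrow> ('n::{finite,linorder}) sq_matrix) \<Rightarrow> bool"
where
  "derivative_coupling X H A \<longleftrightarrow>
     (\<forall>x\<in>X. has_distinct_eigenvalues (H x) \<longrightarrow>
        (\<exists>U u. open U \<and> x \<in> U \<and> U \<subseteq> X \<and> C1_eigenframe_on U H u \<and>
               (\<forall>\<mu>. A x \<mu> = transpose (u x) ** partial_deriv \<mu> u x)))"

section \<open>Graphs on a vertex type, given by their sets of edges\<close>

definition walk :: "'n set set \<Rightarrow> 'n \<Rightarrow> 'n list \<Rightarrow> 'n \<Rightarrow> bool" where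
  "walk E p vs q \<longleftrightarrow> vs \<noteq> [] \<and> hd vs = p \<and> last vs = q \<and> successively (\<lambda>a b. {a, b} \<in> E) vs"

definition graph_connected :: "'n set set \<Rightarrow> bool" where
  "graph_connected E \<longleftrightarrow> (\<forall>p q. \<exists>vs. walk E p vs q)"

definition graph_acyclic :: "'n set set \<Rightarrow> bool" where
  "graph_acyclic E \<longleftrightarrow>
     \<not> (\<exists>vs. 3 \<le> length vs \<and> distinct vs \<and> successively (\<lambda>a b. {a, b} \<in> E) vs \<and>
             {last vs, hd vs} \<in> E)"

definition is_spanning_tree :: "'n set set \<Rightarrow> 'n set set \<Rightarrow> bool" where
  "is_spanning_tree T E \<longleftrightarrow> T \<subseteq> E \<and> graph_connected T \<and> graph_acyclic T"

definition tree_path :: "'n set set \<Rightarrow> 'n \<Rightarrow> 'n \<Rightarrow> 'n list" where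
  "tree_path T p q = (THE vs. walk T p vs q \<and> distinct vs)"

definition interaction_edges :: "('m \<Rightarrow> ('n::finite) sq_matrix) \<Rightarrow> 'n set set" where
  "interaction_edges A = {{m, n} | m n. m \<noteq> n \<and> (\<exists>\<mu>. A \<mu> $ m $ n \<noteq> 0)}"

definition admissible_labels ::
  "(real^'m) set \<Rightarrow> (real^'m \<Rightarrow> 'm \<Rightarrow> ('n::finite) sq_matrix) \<Rightarrow> (real^'m \<Rightarrow> 'n set \<Rightarrow> 'm) \<Rightarrow> bool"
where
  "admissible_labels X A l \<longleftrightarrow>
     (\<forall>x\<in>X. \<forall>m n. {m, n} \<in> interaction_edges (A x) \<longrightarrow> A x (l x {m, n}) $ m $ n \<noteq> 0)"

section \<open>The invariant map\<close>

datatype ('n, 'm) invariant_index =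
    Eigenvalue 'n
  | Pure_Loop 'n 'n 'm
  | Mixed_Loop 'n 'n 'm
  | Cycle_Product 'n 'n 'm

text \<open>The indices of the components present for edge set \<open>E\<close>, spanning tree \<open>T\<close> and labels \<open>l\<close>.\<close>
definition invariant_indices ::
  "'n set set \<Rightarrow> 'n set set \<Rightarrow> ('n set \<Rightarrow> 'm) \<Rightarrow> ('n::linorder, 'm) invariant_index set"
where
  "invariant_indices E T l =
     range Eigenvalue \<union>
     {Pure_Loop m n \<mu> | m n \<mu>. m < n} \<union>
     {Mixed_Loop m n \<mu> | m n \<mu>. m < n \<and> {m, n} \<in> E \<and> \<mu> \<noteq> l {m, n}} \<union>
     {Cycle_Product p q \<mu> | p q \<mu>. p < q \<and> {p, q} \<notin> T}"

text \<open>The components, for a matrix \<open>h = H x\<close> and its couplings \<open>A \<mu>\<close> at \<open>x\<close>.\<close>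
fun invariant_map ::
  "'n set set \<Rightarrow> ('n set \<Rightarrow> 'm) \<Rightarrow> 'n sq_matrix \<Rightarrow> ('m \<Rightarrow> 'n sq_matrix) \<Rightarrow>
   ('n::{finite,linorder}, 'm) invariant_index \<Rightarrow> real"
where
  "invariant_map T l h A (Eigenvalue n) = ordered_eigenvalues h $ n"
| "invariant_map T l h A (Pure_Loop m n \<mu>) = (A \<mu> $ m $ n)\<^sup>2"
| "invariant_map T l h A (Mixed_Loop m n \<mu>) = A (l {m, n}) $ m $ n * A \<mu> $ m $ n"
| "invariant_map T l h A (Cycle_Product p q \<mu>) =
     (let vs = tree_path T p q in
        (\<Prod>r<length vs - 1. A (l {vs ! r, vs ! Suc r}) $ (vs ! r) $ (vs ! Suc r)) * A \<mu> $ q $ p)"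

section \<open>Moduli, distances, path length\<close>

text \<open>
  All of these take values in \<^typ>\<open>ennreal\<close>, so that a supremum over the empty set is \<open>0\<close>, and an
  infimum over the empty set (as in the gap for \<open>N = 1\<close>) is \<open>\<infinity>\<close>.
\<close>

definition gap_modulus ::
  "(real^'m) set \<Rightarrow> (real^'m \<Rightarrow> ('n::{finite,linorder}) sq_matrix) \<Rightarrow> ennreal" where
  "gap_modulus K H =
     (INF x\<in>K. INF (m, n)\<in>{(m, n). m \<noteq> n}.
        ennreal \<bar>ordered_eigenvalues (H x) $ m - ordered_eigenvalues (H x) $ n\<bar>)"

definition bound_modulus ::
  "(real^'m) set \<Rightarrow> (real^'m \<Rightarrow> ('n::finite) sq_matrix) \<Rightarrow> (real^'m \<Rightarrow> 'm \<Rightarrow> 'n sq_matrix) \<Rightarrow> ennreal" where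
  "bound_modulus K H A =
     (SUP x\<in>K. ennreal (norm (H x))) + (MAX \<mu>\<in>UNIV. SUP x\<in>K. ennreal (norm (A x \<mu>)))"

definition conjugation_dist ::
  "(real^'m) set \<Rightarrow> (real^'m \<Rightarrow> ('n::finite) sq_matrix) \<Rightarrow> (real^'m \<Rightarrow> 'n sq_matrix) \<Rightarrow> ennreal" where
  "conjugation_dist K H1 H2 =
     (INF Q\<in>{Q. orthogonal_matrix Q}.
        SUP x\<in>K. ennreal (norm (H2 x - transpose Q ** H1 x ** Q)))"

text \<open>The index sets are always taken from the first (reference) family.\<close>
definition invariant_dist ::
  "(real^'m) set \<Rightarrow> (real^'m \<Rightarrow> 'n set set) \<Rightarrow> (real^'m \<Rightarrow> 'n set \<Rightarrow> 'm) \<Rightarrow>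
   (real^'m \<Rightarrow> 'n sq_matrix) \<Rightarrow> (real^'m \<Rightarrow> 'm \<Rightarrow> 'n sq_matrix) \<Rightarrow>
   (real^'m \<Rightarrow> 'n sq_matrix) \<Rightarrow> (real^'m \<Rightarrow> 'm \<Rightarrow> ('n::{finite,linorder}) sq_matrix) \<Rightarrow> ennreal"
where
  "invariant_dist K T l H1 A1 H2 A2 =
     (if nondegenerate_on K H2 then
        (SUP x\<in>K. SUP i\<in>invariant_indices (interaction_edges (A1 x)) (T x) (l x).
           ennreal \<bar>invariant_map (T x) (l x) (H1 x) (A1 x) i
                    - invariant_map (T x) (l x) (H2 x) (A2 x) i\<bar>)
      else \<infinity>)"

text \<open>The supremum of the lengths of inscribed polygons.\<close>
definition path_length :: "(real \<Rightarrow> 'a::metric_space) \<Rightarrow> ennreal" where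
  "path_length \<gamma> =
     (SUP ts\<in>{ts. sorted ts \<and> set ts \<subseteq> {0..1}}.
        \<Sum>i<length ts - 1. ennreal (dist (\<gamma> (ts ! i)) (\<gamma> (ts ! Suc i))))"

definition path_length_bound :: "'a::metric_space set \<Rightarrow> ennreal \<Rightarrow> bool" where
  "path_length_bound K L \<longleftrightarrow>
     (\<forall>a\<in>K. \<forall>b\<in>K. \<exists>\<gamma>. path \<gamma> \<and> path_image \<gamma> \<subseteq> K \<and> pathstart \<gamma> = a \<and> pathfinish \<gamma> = b \<and>
                        path_length \<gamma> \<le> L)"

end

theory Submission
  imports Defs
begin

text \<open>
  Fix frames \<open>u\<^sub>1\<close>, \<open>u\<^sub>2\<close> of the two families near a point \<open>x\<close> of \<open>K\<close>, with couplings \<open>A\<^sub>1\<close>, \<open>A\<^sub>2\<close>, and let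
  \<open>d\<close> be the distance of the invariants.  The proof compares the families through the orthogonal
  matrix \<open>W = u\<^sub>1 S u\<^sub>2\<^sup>T\<close>, where \<open>S\<close> is a diagonal matrix of signs.  The conjugate \<open>W\<^sup>T H\<^sub>1 x W\<close> has the
  eigenvectors of \<open>H\<^sub>2 x\<close>, so \<open>H\<^sub>2 x - W\<^sup>T H\<^sub>1 x W\<close> only sees the differences of
  the eigenvalues and has norm at most \<open>N d\<close>, whatever the signs.  The signs matter for the
  rate of change of \<open>W\<close>: its partial derivatives are \<open>u\<^sub>1 (A\<^sub>1 - S A\<^sub>2 S) S u\<^sub>2\<^sup>T\<close>.  If \<open>S\<close> can be
  chosen so that all entries of \<open>A\<^sub>1 - S A\<^sub>2 S\<close> are of order \<open>d\<close>, then \<open>W\<close> is nearly constant along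
  paths in \<open>K\<close>, and its value at one base point serves as the orthogonal matrix for all of \<open>K\<close>.

  The signs come from the tree (\<open>couplings_close_up_to_signs\<close>).  On a tree edge the squared
  labelled entries agree up to \<open>d\<close> and are bounded away from \<open>0\<close>, so the entries agree up to order
  \<open>d\<close> and sign; on a tree any prescribed signs of the edges are products of signs of the vertices,
  so some \<open>S\<close> corrects all labelled entries at once.  Conjugation by \<open>S\<close> does not change the loop and
  cycle products.  In the mixed loops of tree edges, and in the cycle products, all factors but one are
  labelled tree entries, already known to be close and bounded away from \<open>0\<close>; dividing by them
  shows that the remaining factors are close.

  The tree and the labels may jump from point to point, so the chosen \<open>S\<close> need not vary
  continuously.  But any two admissible sign choices at nearby points agree up to a global sign:
  on the tree edges at \<open>x\<close> some entry of \<open>A\<^sub>1\<close> stays away from \<open>0\<close> near \<open>x\<close>, which determines the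
  product of the two end signs, and the tree is connected (\<open>signs_rigid\<close>).  Hence \<open>W\<close> is
  locally Lipschitz up to a factor \<open>\<plusminus>1\<close> with a constant of order \<open>d\<close>
  (\<open>intertwiner_locally_lipschitz\<close>).  Chaining this along inscribed polygons of a path
  (\<open>lipschitz_up_to_sign_along_path\<close>) bounds the variation of \<open>W\<close>, up to sign, by a multiple of
  \<open>d L\<close>; the sign disappears in \<open>W\<^sup>T H\<^sub>1 W\<close>.
\<close>

section \<open>Frobenius norm, sign matrices and eigenframes\<close>

lemma norm_matrix_sq: "(norm (A :: real^'n^'m))\<^sup>2 = (\<Sum>i\<in>UNIV. \<Sum>j\<in>UNIV. (A $ i $ j)\<^sup>2)"
  by (simp add: norm_vec_def L2_set_def sum_nonneg)

lemma norm_transpose: "norm (transpose A) = norm (A :: real^'n^'m)"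
proof -
  have "(norm (transpose A))\<^sup>2 = (norm A)\<^sup>2"
    unfolding norm_matrix_sq by (subst sum.swap) (simp add: transpose_def)
  then show ?thesis by simp
qed

lemma entry_le_norm: "\<bar>A $ i $ j\<bar> \<le> norm (A :: real^'n^'m)"
  by (metis component_le_norm_cart Finite_Cartesian_Product.norm_nth_le order_trans real_norm_def)

lemma norm_le_if_entries_le:
  fixes A :: "real^'n^'n"
  assumes "\<And>i j. \<bar>A $ i $ j\<bar> \<le> c"
  shows "norm A \<le> real CARD('n) * c"
proof -
  have "c \<ge> 0" using assms[of undefined undefined] by linarith
  have "(norm A)\<^sup>2 \<le> (\<Sum>i\<in>(UNIV::'n set). \<Sum>j\<in>(UNIV::'n set). c\<^sup>2)"
    unfolding norm_matrix_sq
    by (intro sum_mono) (use assms \<open>c \<ge> 0\<close> in \<open>simp add: abs_le_square_iff[symmetric]\<close>)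
  also have "\<dots> = (real CARD('n) * c)\<^sup>2" by (simp add: power2_eq_square)
  finally show ?thesis by (rule power2_le_imp_le) (use \<open>c \<ge> 0\<close> in simp)
qed

lemma norm_matrix_mult_le: "norm (A ** B) \<le> norm (A :: real^'n^'n) * norm (B :: real^'n^'n)"
proof -
  have "(norm (A ** B))\<^sup>2 \<le> (\<Sum>i\<in>UNIV. \<Sum>j\<in>UNIV. (norm (A $ i))\<^sup>2 * (norm (transpose B $ j))\<^sup>2)"
    unfolding norm_matrix_sq
  proof (intro sum_mono)
    fix i j
    have "(A ** B) $ i $ j = A $ i \<bullet> transpose B $ j"
      by (simp add: matrix_matrix_mult_def inner_vec_def transpose_def)
    then show "((A ** B) $ i $ j)\<^sup>2 \<le> (norm (A $ i))\<^sup>2 * (norm (transpose B $ j))\<^sup>2"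
      by (simp add: Cauchy_Schwarz_ineq2 abs_le_square_iff[symmetric] flip: power_mult_distrib)
  qed
  also have "\<dots> = (\<Sum>i\<in>UNIV. (norm (A $ i))\<^sup>2) * (\<Sum>j\<in>UNIV. (norm (transpose B $ j))\<^sup>2)"
    by (simp add: sum_product)
  also have "\<dots> = (norm A)\<^sup>2 * (norm (transpose B))\<^sup>2"
    by (simp add: norm_vec_def L2_set_def sum_nonneg)
  finally have "(norm (A ** B))\<^sup>2 \<le> (norm A * norm B)\<^sup>2"
    by (simp add: norm_transpose power_mult_distrib)
  then show ?thesis by (rule power2_le_imp_le) simp
qed

lemma bounded_bilinear_matrix_mult:
  "bounded_bilinear ((**) :: real^'n^'n \<Rightarrow> real^'n^'n \<Rightarrow> real^'n^'n)"
proof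
  show "\<exists>K. \<forall>a b. norm ((a::real^'n^'n) ** (b::real^'n^'n)) \<le> norm a * norm b * K"
    by (rule exI[of _ 1]) (simp add: norm_matrix_mult_le)
qed (simp_all add: matrix_add_ldistrib scalar_matrix_assoc matrix_scalar_ac,
    simp add: vec_eq_iff matrix_matrix_mult_def distrib_right sum.distrib)

lemmas matrix_mult_diff_left = bounded_bilinear.diff_left[OF bounded_bilinear_matrix_mult]
lemmas matrix_mult_diff_right = bounded_bilinear.diff_right[OF bounded_bilinear_matrix_mult]

lemma bounded_linear_transpose: "bounded_linear (transpose :: real^'n^'n \<Rightarrow> real^'n^'n)"
  by (rule bounded_linear_intro[where K = 1])
    (simp_all add: norm_transpose, simp_all add: transpose_def vec_eq_iff)

lemma orthogonal_matrix_transpose_self: "orthogonal_matrix (transpose Q) \<longleftrightarrow> orthogonal_matrix Q"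
  by (auto simp: orthogonal_matrix_def)

lemma norm_orthogonal_mult_right:
  fixes A Q :: "real^'n^'n"
  assumes "orthogonal_matrix Q"
  shows "norm (A ** Q) = norm A"
proof -
  have "norm ((A ** Q) $ i) = norm (A $ i)" for i
  proof -
    have "(A ** Q) $ i = transpose Q *v (A $ i)"
      by (simp add: vec_eq_iff matrix_matrix_mult_def vector_matrix_mult_def mult.commute)
    moreover have "orthogonal_transformation ((*v) (transpose Q))"
      using assms
      by (simp add: orthogonal_transformation_matrix orthogonal_matrix_transpose_self
          matrix_vector_mul_linear del: transpose_matrix_vector)
    ultimately show ?thesis by (simp add: orthogonal_transformation)
  qed
  then show ?thesis by (simp add: norm_vec_def)
qed

lemma norm_orthogonal_mult_left:
  fixes A Q :: "real^'n^'n"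
  assumes "orthogonal_matrix Q"
  shows "norm (Q ** A) = norm A"
  by (metis assms matrix_transpose_mul norm_orthogonal_mult_right norm_transpose
      orthogonal_matrix_transpose_self)

definition sign_vector :: "real^'n \<Rightarrow> bool" where
  "sign_vector s \<longleftrightarrow> (\<forall>i. s $ i = 1 \<or> s $ i = - 1)"

lemma sign_vector_sq: "sign_vector s \<Longrightarrow> s $ i * s $ i = 1"
  unfolding sign_vector_def by (metis mult_1 mult_minus_left mult_minus_right minus_minus)

lemma sign_vector_abs: "sign_vector s \<Longrightarrow> \<bar>s $ i\<bar> = 1"
  unfolding sign_vector_def by (metis abs_1 abs_minus_cancel)

lemma diag_mult_entry: "(diag_matrix s ** A) $ i $ j = s $ i * (A :: real^'n^'n) $ i $ j"
  by (simp add: matrix_matrix_mult_def diag_matrix_def if_distrib[of "\<lambda>z. z * _"] sum.delta'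
      cong: if_cong)

lemma mult_diag_entry: "(A ** diag_matrix s) $ i $ j = (A :: real^'n^'n) $ i $ j * s $ j"
  by (simp add: matrix_matrix_mult_def diag_matrix_def if_distrib[of "\<lambda>z. _ * z"] sum.delta
      cong: if_cong)

lemma transpose_diag: "transpose (diag_matrix s) = diag_matrix s"
  by (simp add: transpose_def diag_matrix_def vec_eq_iff)

lemma diag_mult_diag: "diag_matrix s ** diag_matrix t = diag_matrix (\<chi> i. s $ i * t $ i)"
  by (simp add: vec_eq_iff diag_mult_entry) (simp add: diag_matrix_def)

lemma diag_sign_sq: "sign_vector s \<Longrightarrow> diag_matrix s ** diag_matrix s = mat 1"
  by (simp add: diag_mult_diag sign_vector_sq) (simp add: diag_matrix_def mat_def vec_eq_iff)

lemma orthogonal_diag_sign: "sign_vector s \<Longrightarrow> orthogonal_matrix (diag_matrix s)"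
  by (simp add: orthogonal_matrix transpose_diag diag_sign_sq)

lemma orthogonal_diagonal_is_sign:
  assumes "orthogonal_matrix (diag_matrix s)"
  shows "sign_vector s"
  unfolding sign_vector_def
proof
  fix i
  have "diag_matrix s ** diag_matrix s = mat 1"
    using assms by (simp add: orthogonal_matrix transpose_diag)
  then have "(diag_matrix s ** diag_matrix s) $ i $ i = (mat 1 :: real^'a^'a) $ i $ i" by simp
  then have "s $ i * s $ i = 1"
    by (simp add: diag_mult_entry) (simp add: diag_matrix_def mat_def)
  then show "s $ i = 1 \<or> s $ i = - 1" by (simp add: square_eq_1_iff)
qed

text \<open>
  The change of basis \<open>P\<close> between two frames commutes with a diagonal matrix of distinct entries, so
  it is diagonal; a diagonal orthogonal matrix consists of signs.  The signs are given explicitly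
  so that they vary continuously when the frames do.
\<close>
lemma eigenframe_unique_up_to_signs:
  fixes u v H :: "real^'n^'n"
  assumes u: "orthogonal_matrix u" "transpose u ** H ** u = diag_matrix e"
    and v: "orthogonal_matrix v" "transpose v ** H ** v = diag_matrix e"
    and "inj (\<lambda>i. e $ i)"
  defines "s \<equiv> (\<chi> i. (transpose u ** v) $ i $ i)"
  shows "sign_vector s" and "v = u ** diag_matrix s"
proof -
  define P where "P = transpose u ** v"
  have uu: "u ** transpose u = mat 1" and vv: "v ** transpose v = mat 1"
    using u v by (auto simp: orthogonal_matrix_def)
  have "diag_matrix e ** P = transpose u ** H ** (u ** transpose u) ** v"
    unfolding P_def u(2)[symmetric] by (simp add: matrix_mul_assoc)
  also have "\<dots> = transpose u ** (v ** transpose v) ** H ** v"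
    unfolding uu vv by simp
  also have "\<dots> = P ** diag_matrix e"
    unfolding P_def v(2)[symmetric] by (simp add: matrix_mul_assoc)
  finally have "e $ i * P $ i $ j = P $ i $ j * e $ j" for i j
    by (metis diag_mult_entry mult_diag_entry)
  then have "P $ i $ j = 0" if "i \<noteq> j" for i j
    using that \<open>inj (\<lambda>i. e $ i)\<close> by (metis injD mult.commute mult_right_cancel)
  then have P: "P = diag_matrix s"
    by (auto simp: vec_eq_iff diag_matrix_def s_def P_def)
  have "orthogonal_matrix P"
    unfolding P_def using u v by (simp add: orthogonal_matrix_mul orthogonal_matrix_transpose_self)
  with P show "sign_vector s" by (simp add: orthogonal_diagonal_is_sign)
  have "u ** P = v"
    unfolding P_def by (simp add: matrix_mul_assoc uu)
  with P show "v = u ** diag_matrix s" by simp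
qed

section \<open>Couplings of eigenframes\<close>

definition frame_coupling :: "(real^'m \<Rightarrow> ('n::finite) sq_matrix) \<Rightarrow> real^'m \<Rightarrow> 'm \<Rightarrow> 'n sq_matrix" where
  "frame_coupling u x \<mu> = transpose (u x) ** partial_deriv \<mu> u x"

lemma C1_on_has_derivative:
  assumes "C1_on U f" "x \<in> U"
  shows "(f has_derivative frechet_derivative f (at x)) (at x)"
  using assms frechet_derivative_works[of f "at x"] unfolding C1_on_def differentiable_def by blast

lemma C1_on_isCont: "C1_on U f \<Longrightarrow> x \<in> U \<Longrightarrow> isCont f x"
  using C1_on_has_derivative has_derivative_continuous by blast

lemma C1_on_isCont_partial_deriv:
  assumes "C1_on U f" "open U" "x \<in> U"
  shows "isCont (partial_deriv \<mu> f) x"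
proof -
  obtain f' where f': "\<And>x. x \<in> U \<Longrightarrow> (f has_derivative blinfun_apply (f' x)) (at x)"
    and cont: "continuous_on U f'"
    using assms unfolding C1_on_def by blast
  have eq: "partial_deriv \<mu> f y = f' y (axis \<mu> 1)" if "y \<in> U" for y
    unfolding partial_deriv_def using frechet_derivative_at[OF f'[OF that]] by simp
  have "continuous_on U (\<lambda>y. f' y (axis \<mu> 1))" by (intro continuous_intros cont)
  then have "continuous_on U (partial_deriv \<mu> f)" by (simp add: eq cong: continuous_on_cong)
  then show ?thesis using assms continuous_on_eq_continuous_at by blast
qed

lemma isCont_frame_coupling:
  assumes "C1_on U u" "open U" "x \<in> U"
  shows "isCont (\<lambda>y. frame_coupling u y \<mu>) x"
  unfolding frame_coupling_def
  by (intro bounded_bilinear.isCont[OF bounded_bilinear_matrix_mult]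
      bounded_linear.isCont[OF bounded_linear_transpose] C1_on_isCont[OF assms(1,3)]
      C1_on_isCont_partial_deriv[OF assms])

text \<open>
  Differentiate \<open>u\<^sup>T u = 1\<close>.
\<close>
lemma frame_coupling_skew:
  assumes "C1_on U u" "open U" "x \<in> U" "\<And>y. y \<in> U \<Longrightarrow> orthogonal_matrix (u y)"
  shows "transpose (frame_coupling u x \<mu>) = - frame_coupling u x \<mu>"
proof -
  let ?d = "frechet_derivative u (at x)"
  have D: "(u has_derivative ?d) (at x)" by (rule C1_on_has_derivative[OF assms(1,3)])
  have Dt: "((\<lambda>y. transpose (u y)) has_derivative (\<lambda>h. transpose (?d h))) (at x)"
    by (rule bounded_linear.has_derivative[OF bounded_linear_transpose D])
  have 1: "((\<lambda>y. transpose (u y) ** u y) has_derivative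
      (\<lambda>h. transpose (u x) ** ?d h + transpose (?d h) ** u x)) (at x)"
    by (rule bounded_bilinear.FDERIV[OF bounded_bilinear_matrix_mult Dt D])
  have "((\<lambda>y. transpose (u y) ** u y) has_derivative (\<lambda>h. 0)) (at x)"
    by (rule has_derivative_transform_within_open[OF has_derivative_const assms(2,3)])
      (use assms(4) in \<open>simp add: orthogonal_matrix\<close>)
  from has_derivative_unique[OF 1 this]
  have "transpose (u x) ** ?d (axis \<mu> 1) + transpose (?d (axis \<mu> 1)) ** u x = 0" by meson
  then have "frame_coupling u x \<mu> + transpose (frame_coupling u x \<mu>) = 0"
    by (simp add: frame_coupling_def partial_deriv_def matrix_transpose_mul)
  then show ?thesis by (simp add: eq_neg_iff_add_eq_0 add.commute)
qed

text \<open>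
  The signs relating two frames are continuous functions of the point with values in a discrete set,
  hence constant near \<open>x\<close>; so they commute with differentiation.
\<close>
lemma eigenframe_couplings_conjugate:
  fixes u v :: "real^'m \<Rightarrow> ('n::{finite,linorder}) sq_matrix"
  assumes "open U" "open V" "x \<in> U" "x \<in> V" "C1_eigenframe_on U H u" "C1_eigenframe_on V H v"
  obtains s where "sign_vector s" "v x = u x ** diag_matrix s"
    "\<And>\<mu>. frame_coupling v x \<mu> = diag_matrix s ** frame_coupling u x \<mu> ** diag_matrix s"
proof -
  define s where "s y = (\<chi> i. (transpose (u y) ** v y) $ i $ i)" for y
  have s: "sign_vector (s y)" "v y = u y ** diag_matrix (s y)" if "y \<in> U" "y \<in> V" for y
    using eigenframe_unique_up_to_signs[of "u y" "H y" "ordered_eigenvalues (H y)" "v y"]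
      assms(5,6) that strict_mono_imp_inj_on
    unfolding C1_eigenframe_on_def s_def by auto
  have cu: "C1_on U u" and cv: "C1_on V v" using assms unfolding C1_eigenframe_on_def by auto
  have "isCont (\<lambda>y. transpose (u y) ** v y) x"
    by (intro bounded_bilinear.isCont[OF bounded_bilinear_matrix_mult]
      bounded_linear.isCont[OF bounded_linear_transpose] C1_on_isCont[OF cu] C1_on_isCont[OF cv] assms)
  then have "isCont s x"
    unfolding s_def isCont_def by (intro tendsto_intros) 
  then obtain e where e: "e > 0" "\<And>y. dist y x < e \<Longrightarrow> dist (s y) (s x) < 1"
    unfolding continuous_at_eps_delta by (metis zero_less_one)
  have const: "s y = s x" if "dist y x < e" "y \<in> U" "y \<in> V" for y
  proof -
    have "s y $ i = s x $ i" for i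
    proof -
      have "\<bar>s y $ i - s x $ i\<bar> < 1"
        using e(2)[OF that(1)] component_le_norm_cart[of "s y - s x" i]
        by (simp add: dist_norm)
      moreover have "s y $ i = 1 \<or> s y $ i = -1" "s x $ i = 1 \<or> s x $ i = -1"
        using s(1) that assms(3,4) unfolding sign_vector_def by auto
      ultimately show ?thesis by auto
    qed
    then show ?thesis by (simp add: vec_eq_iff)
  qed
  have D: "((\<lambda>y. u y ** diag_matrix (s x)) has_derivative
      (\<lambda>h. frechet_derivative u (at x) h ** diag_matrix (s x))) (at x)"
    by (rule bounded_linear.has_derivative[OF bounded_bilinear.bounded_linear_left[OF
          bounded_bilinear_matrix_mult] C1_on_has_derivative[OF cu assms(3)]])
  have eq: "u y ** diag_matrix (s x) = v y" if "y \<in> U \<inter> V \<inter> ball x e" for y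
    using s(2)[of y] const[of y] that by (simp add: dist_commute)
  have "(v has_derivative (\<lambda>h. frechet_derivative u (at x) h ** diag_matrix (s x))) (at x)"
    by (rule has_derivative_transform_within_open[OF D, of "U \<inter> V \<inter> ball x e"])
      (simp_all add: assms e(1) open_Int eq)
  then have "frechet_derivative v (at x) = (\<lambda>h. frechet_derivative u (at x) h ** diag_matrix (s x))"
    by (rule frechet_derivative_at[symmetric])
  then have "frame_coupling v x \<mu> =
      diag_matrix (s x) ** frame_coupling u x \<mu> ** diag_matrix (s x)" for \<mu>
    using s(2)[OF assms(3,4)]
    by (simp add: frame_coupling_def partial_deriv_def matrix_transpose_mul transpose_diag
        matrix_mul_assoc)
  then show thesis by (rule that[OF s[OF assms(3,4)]])
qed

section \<open>Paths in trees\<close>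

lemma walk_Cons:
  "walk E p (p' # vs) q \<longleftrightarrow> p = p' \<and> (vs = [] \<and> p = q \<or> {p, hd vs} \<in> E \<and> walk E (hd vs) vs q)"
  by (cases vs) (auto simp: walk_def)

lemma walk_split:
  "walk E p (as @ n # bs) q \<longleftrightarrow> walk E p (as @ [n]) n \<and> walk E n (n # bs) q"
  by (cases as) (auto simp: walk_def successively_append_iff successively_Cons hd_append)

lemma walk_append:
  assumes "walk E p as q" "walk E q (q # bs) r"
  shows "walk E p (as @ bs) r"
proof -
  have "as = butlast as @ [q]" using assms(1) by (auto simp: walk_def)
  then show ?thesis using assms walk_split[of E p "butlast as" q bs r] by (metis append.assoc append_Cons append_Nil)
qed

lemma walk_rev: "walk E p vs q \<Longrightarrow> walk E q (rev vs) p"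
  by (auto simp: walk_def hd_rev last_rev insert_commute)

text \<open>
  Adding a vertex in front of a path produces either a path or a closed initial part, which is cut off.
\<close>
lemma walk_shorten:
  assumes "walk E p vs q"
  shows "\<exists>ws. walk E p ws q \<and> distinct ws \<and> set ws \<subseteq> set vs"
  using assms
proof (induction vs arbitrary: p)
  case Nil
  then show ?case by (simp add: walk_def)
next
  case (Cons p' vs)
  show ?case
  proof (cases "vs = []")
    case True
    then show ?thesis using Cons.prems by (intro exI[of _ "[p]"]) (auto simp: walk_def)
  next
    case False
    then have p: "p' = p" "{p, hd vs} \<in> E" "walk E (hd vs) vs q"
      using Cons.prems by (auto simp: walk_Cons)
    then obtain ws where ws: "walk E (hd vs) ws q" "distinct ws" "set ws \<subseteq> set vs"
      using Cons.IH by blast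
    show ?thesis
    proof (cases "p \<in> set ws")
      case True
      then obtain as bs where "ws = as @ p # bs" by (meson split_list)
      then show ?thesis
        using ws p walk_split[of E "hd vs" as p bs q] by (intro exI[of _ "p # bs"]) auto
    next
      case False
      moreover have "ws \<noteq> []" "hd ws = hd vs" using ws by (auto simp: walk_def)
      ultimately show ?thesis
        using ws p by (intro exI[of _ "p # ws"]) (auto simp: walk_Cons)
    qed
  qed
qed

text \<open>
  Past their common initial part, two different paths leave a vertex \<open>p\<close> along different edges.  Their
  remainders avoid \<open>p\<close> and meet at the end, so together they connect the two neighbours of \<open>p\<close>
  without passing through \<open>p\<close>, and \<open>p\<close> closes a cycle.
\<close>
lemma acyclic_path_unique:
  assumes "graph_acyclic E"
    and "walk E p vs q" "distinct vs" "walk E p ws q" "distinct ws"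
  shows "vs = ws"
  using assms(2-)
proof (induction vs arbitrary: p ws)
  case Nil
  then show ?case by (simp add: walk_def)
next
  case (Cons p' vs)
  have p': "p' = p" using Cons.prems by (simp add: walk_Cons)
  obtain ws' where ws': "ws = p # ws'"
    using Cons.prems(3) by (cases ws) (auto simp: walk_def)
  show ?case
  proof (cases "vs = [] \<or> ws' = []")
    case True
    with Cons.prems p' ws' show ?thesis by (auto simp: walk_def split: if_splits)
  next
    case False
    have v: "{p, hd vs} \<in> E" "walk E (hd vs) vs q" "p \<notin> set vs" "distinct vs"
      using Cons.prems False p' by (auto simp: walk_Cons)
    have w: "{p, hd ws'} \<in> E" "walk E (hd ws') ws' q" "p \<notin> set ws'" "distinct ws'"
      using Cons.prems False ws' by (auto simp: walk_Cons)
    have "hd vs = hd ws'"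
    proof (rule ccontr)
      assume ne: "hd vs \<noteq> hd ws'"
      obtain us where us: "rev ws' = q # us"
        using walk_rev[OF w(2)] by (cases "rev ws'") (auto simp: walk_def)
      then have "walk E q (q # us) (hd ws')" using walk_rev[OF w(2)] by simp
      from walk_shorten[OF walk_append[OF v(2) this]]
      obtain zs where zs: "walk E (hd vs) zs (hd ws')" "distinct zs"
        "set zs \<subseteq> set (vs @ us)"
        by auto
      have "set us \<subseteq> set ws'" using us by (metis set_rev set_subset_Cons)
      with zs(3) v w have "p \<notin> set zs" by auto
      moreover obtain a b cs where abc: "zs = a # b # cs"
        using zs(1) ne by (cases zs rule: remdups_adj.cases) (auto simp: walk_def)
      ultimately have "3 \<le> length (p # zs) \<and> distinct (p # zs) \<and>
          successively (\<lambda>a b. {a, b} \<in> E) (p # zs) \<and> {last (p # zs), hd (p # zs)} \<in> E"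
        using zs v(1) w(1) by (auto simp: walk_def insert_commute)
      with assms(1) show False unfolding graph_acyclic_def by blast
    qed
    with w have "walk E (hd vs) ws' q" by simp
    then have "vs = ws'" by (rule Cons.IH[OF v(2,4) _ w(4)])
    then show ?thesis by (simp add: p' ws')
  qed
qed

lemma tree_path_props:
  assumes "graph_connected T" "graph_acyclic T"
  shows "walk T p (tree_path T p q) q" "distinct (tree_path T p q)"
proof -
  obtain us where "walk T p us q" using assms(1) unfolding graph_connected_def by blast
  from walk_shorten[OF this] obtain vs where vs: "walk T p vs q" "distinct vs" by auto
  have "tree_path T p q = vs"
    unfolding tree_path_def
  proof (rule the_equality)
    show "ws = vs" if "walk T p ws q \<and> distinct ws" for ws
      using that vs acyclic_path_unique[OF assms(2)] by metis
  qed (use vs in auto)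
  with vs show "walk T p (tree_path T p q) q" "distinct (tree_path T p q)" by auto
qed

lemma tree_path_eqI:
  assumes "graph_connected T" "graph_acyclic T" "walk T p vs q" "distinct vs"
  shows "tree_path T p q = vs"
  by (rule acyclic_path_unique[OF assms(2) tree_path_props[OF assms(1,2)] assms(3,4)])

text \<open>
  The product along a walk, by recursion on the list so that estimates go by induction; it equals the
  indexed product in the cycle products.
\<close>
fun edge_product :: "('n \<Rightarrow> 'n \<Rightarrow> real) \<Rightarrow> 'n list \<Rightarrow> real" where
  "edge_product f (a # b # vs) = f a b * edge_product f (b # vs)"
| "edge_product f _ = 1"

lemma edge_product_eq_prod:
  "(\<Prod>r<length vs - 1. f (vs ! r) (vs ! Suc r)) = edge_product f vs"
  by (induction f vs rule: edge_product.induct) (simp_all add: prod.lessThan_Suc_shift del: prod.lessThan_Suc)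

lemma edge_product_snoc:
  "edge_product f (vs @ [a, b]) = edge_product f (vs @ [a]) * f a b"
  by (induction f vs rule: edge_product.induct) auto

text \<open>
  Give each vertex the product of the prescribed edge signs along the path from a root.  Of the two
  ends of an edge, at least one is not on the path to the other, and extending that path by the edge
  gives the path to the first.
\<close>
lemma tree_signs_exist:
  fixes T :: "'n set set" and \<sigma> :: "'n \<Rightarrow> 'n \<Rightarrow> real"
  assumes T: "graph_connected T" "graph_acyclic T" and "\<And>m. {m, m} \<notin> T"
    and \<sigma>: "\<And>m n. \<sigma> m n = 1 \<or> \<sigma> m n = -1" "\<And>m n. \<sigma> m n = \<sigma> n m"
  shows "\<exists>s. (\<forall>m. s m = 1 \<or> s m = -1) \<and> (\<forall>m n. {m, n} \<in> T \<longrightarrow> s m * s n = \<sigma> m n)"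
proof -
  define r :: 'n where "r = undefined"
  define s where "s v = edge_product \<sigma> (tree_path T r v)" for v
  have pm: "edge_product \<sigma> vs = 1 \<or> edge_product \<sigma> vs = -1" for vs
  proof (induction vs rule: induct_list012)
    case (3 a b vs)
    then show ?case using \<sigma>(1)[of a b] by auto
  qed auto
  have ext: "s n = s m * \<sigma> m n" if "{m, n} \<in> T" "n \<notin> set (tree_path T r m)" for m n
  proof -
    obtain vs where vs: "tree_path T r m = vs @ [m]"
      using tree_path_props(1)[OF T, of r m] by (metis append_butlast_last_id walk_def)
    have "tree_path T r n = (vs @ [m]) @ [n]"
    proof (rule tree_path_eqI[OF T])
      have "walk T r (vs @ [m]) m" using tree_path_props(1)[OF T, of r m] vs by simp
      moreover have "walk T m [m, n] n" using that(1) by (simp add: walk_def)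
      ultimately show "walk T r ((vs @ [m]) @ [n]) n" by (rule walk_append)
      show "distinct ((vs @ [m]) @ [n])"
        using tree_path_props(2)[OF T, of r m] that unfolding vs by auto
    qed
    then show ?thesis by (simp add: s_def vs edge_product_snoc)
  qed
  have dich: "n \<notin> set (tree_path T r m) \<or> m \<notin> set (tree_path T r n)" if mn: "{m, n} \<in> T" for m n
  proof (rule ccontr)
    \<comment> \<open>If \<open>n\<close> is on the path to \<open>m\<close>, then the path to \<open>n\<close> stops before reaching \<open>m\<close>, the last vertex.\<close>
    assume "\<not> ?thesis"
    then have n: "n \<in> set (tree_path T r m)" and m: "m \<in> set (tree_path T r n)" by auto
    have "m \<noteq> n" using assms(3) mn by auto
    obtain as bs where ab: "tree_path T r m = as @ n # bs" using n by (meson split_list)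
    have p: "walk T r (as @ n # bs) m" "distinct (as @ n # bs)"
      using tree_path_props[OF T, of r m] ab by auto
    have "walk T r (as @ [n]) n" "walk T n (n # bs) m" using p(1) walk_split[of T r as n bs m] by auto
    have "tree_path T r n = as @ [n]"
      by (rule tree_path_eqI[OF T]) (use p \<open>walk T r (as @ [n]) n\<close> in auto)
    then have "m \<in> set as" using m \<open>m \<noteq> n\<close> by auto
    moreover have "m \<in> set (n # bs)"
      using \<open>walk T n (n # bs) m\<close> by (metis last_in_set list.distinct(1) walk_def)
    ultimately show False using p(2) by auto
  qed
  have "s m * s n = \<sigma> m n" if "{m, n} \<in> T" for m n
    using dich[OF that] ext[of m n] ext[of n m] that pm[of "tree_path T r m"] pm[of "tree_path T r n"]
      \<sigma>(2)[of m n]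
    by (auto simp: s_def insert_commute)
  then show ?thesis using pm by (intro exI[of _ s]) (auto simp: s_def)
qed

lemma connected_propagate:
  assumes "graph_connected T" and "\<And>m n. {m, n} \<in> T \<Longrightarrow> f m = f n"
  shows "f p = f q"
proof -
  have "f p = f q" if "walk T p vs q" for vs
    using that
  proof (induction vs arbitrary: p)
    case (Cons a vs)
    then show ?case using assms(2) by (auto simp: walk_Cons)
  qed (simp add: walk_def)
  then show ?thesis using assms(1) unfolding graph_connected_def by blast
qed

section \<open>Recovering the couplings from the invariants\<close>

lemma edge_product_abs_bounds:
  assumes "successively (\<lambda>a b. \<kappa> \<le> \<bar>f a b\<bar> \<and> \<bar>f a b\<bar> \<le> \<beta>) vs" "0 \<le> \<kappa>" "\<kappa> \<le> 1" "1 \<le> \<beta>"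
  shows "\<kappa> ^ length vs \<le> \<bar>edge_product f vs\<bar>" "\<bar>edge_product f vs\<bar> \<le> \<beta> ^ length vs"
proof -
  have "\<kappa> ^ length vs \<le> \<bar>edge_product f vs\<bar> \<and> \<bar>edge_product f vs\<bar> \<le> \<beta> ^ length vs"
    using assms(1)
  proof (induction vs rule: induct_list012)
    case 1
    then show ?case by simp
  next
    case (2 a)
    then show ?case using assms by simp
  next
    case (3 a b vs)
    then have "\<kappa> * \<kappa> ^ length (b # vs) \<le> \<bar>f a b\<bar> * \<bar>edge_product f (b # vs)\<bar>"
      "\<bar>f a b\<bar> * \<bar>edge_product f (b # vs)\<bar> \<le> \<beta> * \<beta> ^ length (b # vs)"
      using assms(2-4) by (intro mult_mono; simp)+
    then show ?case by (simp add: abs_mult)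
  qed
  then show "\<kappa> ^ length vs \<le> \<bar>edge_product f vs\<bar>" "\<bar>edge_product f vs\<bar> \<le> \<beta> ^ length vs" by auto
qed

lemma edge_product_diff_bound:
  assumes "successively (\<lambda>a b. \<bar>f a b\<bar> \<le> \<beta> \<and> \<bar>h a b\<bar> \<le> \<beta> \<and> \<bar>f a b - h a b\<bar> \<le> \<eta>) vs" "1 \<le> \<beta>" "0 \<le> \<eta>"
  shows "\<bar>edge_product f vs - edge_product h vs\<bar> \<le> real (length vs) * \<beta> ^ length vs * \<eta>"
  using assms(1)
proof (induction vs rule: induct_list012)
  case 1
  then show ?case by simp
next
  case (2 a)
  then show ?case using assms by simp
next
  case (3 a b vs)
  let ?n = "length (b # vs)" and ?f = "edge_product f (b # vs)" and ?h = "edge_product h (b # vs)"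
  have "successively (\<lambda>a b. 0 \<le> \<bar>f a b\<bar> \<and> \<bar>f a b\<bar> \<le> \<beta>) (b # vs)"
    using 3 by (auto elim: successively_mono)
  then have "\<bar>?f\<bar> \<le> \<beta> ^ ?n"
    by (rule edge_product_abs_bounds) (use assms in auto)
  then have 1: "\<bar>f a b - h a b\<bar> * \<bar>?f\<bar> \<le> \<eta> * \<beta> ^ ?n"
    using 3 assms by (intro mult_mono) auto
  have 2: "\<bar>h a b\<bar> * \<bar>?f - ?h\<bar> \<le> \<beta> * (real ?n * \<beta> ^ ?n * \<eta>)"
    using 3 assms by (intro mult_mono) auto
  have 3: "\<eta> * \<beta> ^ ?n \<le> \<beta> * (\<beta> ^ ?n * \<eta>)"
    using mult_right_mono[OF assms(2), of "\<beta> ^ ?n * \<eta>"] assms by (simp add: mult.commute)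
  have "edge_product f (a # b # vs) - edge_product h (a # b # vs)
      = (f a b - h a b) * ?f + h a b * (?f - ?h)"
    by (simp add: algebra_simps)
  then have "\<bar>edge_product f (a # b # vs) - edge_product h (a # b # vs)\<bar>
      \<le> \<bar>f a b - h a b\<bar> * \<bar>?f\<bar> + \<bar>h a b\<bar> * \<bar>?f - ?h\<bar>"
    by (metis abs_mult abs_triangle_ineq)
  also have "\<dots> \<le> \<beta> * (\<beta> ^ ?n * \<eta>) + \<beta> * (real ?n * \<beta> ^ ?n * \<eta>)" using 1 2 3 by linarith
  also have "\<dots> = real (length (a # b # vs)) * \<beta> ^ length (a # b # vs) * \<eta>"
    by (simp add: algebra_simps)
  finally show ?case .
qed

text \<open>
  The signs of the inner vertices occur twice.
\<close>
lemma edge_product_gauge: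
  fixes s :: "real^'n"
  assumes "sign_vector s" "walk E p vs q"
  shows "edge_product (\<lambda>m n. s $ m * f m n * s $ n) vs = s $ p * edge_product f vs * s $ q"
  using assms(2)
proof (induction vs arbitrary: p rule: induct_list012)
  case 1
  then show ?case by (simp add: walk_def)
next
  case (2 a)
  then show ?case using sign_vector_sq[OF assms(1)] by (auto simp: walk_def)
next
  case (3 a b vs)
  then have "a = p" "walk E b (b # vs) q" by (auto simp: walk_Cons)
  then show ?case using 3(2)[of b] sign_vector_sq[OF assms(1), of b] by simp
qed

text \<open>
  The two summands are the factors lost on the pairs that are tree edges and on the pairs that are
  not: in both cases one divides an error by known factors, a single one of size at least \<open>\<kappa>\<close> for an
  edge, and at most \<open>N\<close> of them for a pair that is joined by a tree path.
\<close>
definition gauge_const :: "nat \<Rightarrow> real \<Rightarrow> real \<Rightarrow> real" where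
  "gauge_const N \<kappa> \<beta> = (1 + \<beta> / \<kappa>) / \<kappa> + (1 + real N * \<beta> ^ Suc N / \<kappa>) / \<kappa> ^ N"

lemma gauge_const_pos: "0 < \<kappa> \<Longrightarrow> 0 \<le> \<beta> \<Longrightarrow> 0 < gauge_const N \<kappa> \<beta>"
  unfolding gauge_const_def by (intro add_pos_nonneg divide_pos_pos divide_nonneg_nonneg) (auto intro: add_pos_nonneg)

lemma sq_close_same_sign:
  fixes a b :: real
  assumes "\<bar>a\<^sup>2 - b\<^sup>2\<bar> \<le> d" "0 \<le> a * b" "\<kappa> \<le> \<bar>a\<bar>" "0 < \<kappa>"
  shows "\<bar>a - b\<bar> \<le> d / \<kappa>"
proof -
  have "\<kappa> \<le> \<bar>a + b\<bar>" using assms(2-4) by (auto simp: zero_le_mult_iff)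
  then have "\<bar>a - b\<bar> * \<kappa> \<le> \<bar>a - b\<bar> * \<bar>a + b\<bar>" by (intro mult_left_mono) auto
  also have "\<dots> = \<bar>a\<^sup>2 - b\<^sup>2\<bar>" by (simp add: abs_mult[symmetric] power2_eq_square algebra_simps)
  finally show ?thesis using assms by (simp add: pos_le_divide_eq)
qed

text \<open>
  Approximate cancellation of a factor that is bounded away from \<open>0\<close>.
\<close>
lemma product_close_imp_factor_close:
  fixes p p' a a' :: real
  assumes "\<bar>p * a - p' * a'\<bar> \<le> d" "\<bar>p - p'\<bar> \<le> e" "\<bar>a'\<bar> \<le> \<beta>" "\<kappa> \<le> \<bar>p\<bar>" "0 < \<kappa>"
  shows "\<bar>a - a'\<bar> \<le> (d + e * \<beta>) / \<kappa>"
proof -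
  have "\<bar>p - p'\<bar> * \<bar>a'\<bar> \<le> e * \<beta>" using assms by (intro mult_mono) auto
  moreover have "\<kappa> * \<bar>a - a'\<bar> \<le> \<bar>p\<bar> * \<bar>a - a'\<bar>" using assms by (intro mult_right_mono) auto
  moreover have "p * (a - a') = (p * a - p' * a') - (p - p') * a'" by (simp add: algebra_simps)
  then have "\<bar>p\<bar> * \<bar>a - a'\<bar> \<le> \<bar>p * a - p' * a'\<bar> + \<bar>p - p'\<bar> * \<bar>a'\<bar>"
    by (metis abs_mult abs_triangle_ineq4)
  ultimately have "\<kappa> * \<bar>a - a'\<bar> \<le> d + e * \<beta>" using assms(1) by linarith
  then show ?thesis using assms(5) by (simp add: pos_le_divide_eq mult.commute)
qed

text \<open>
  The signs are chosen to correct the labelled entries on the tree edges.  The entries of a tree edge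
  in the other directions then follow from the mixed loops, and those of all other pairs from the
  cycle products, whose tree part is a product of labelled entries.  The bound \<open>\<beta> - 1\<close> on \<open>a\<close> leaves
  room for \<open>b\<close> to be bounded by \<open>\<beta>\<close>.
\<close>
lemma couplings_close_up_to_signs:
  fixes a b :: "'m \<Rightarrow> ('n::{finite,linorder}) sq_matrix" and l :: "'n set \<Rightarrow> 'm"
  assumes T: "graph_connected T" "graph_acyclic T" "\<And>m. {m, m} \<notin> T"
    and skew: "\<And>\<mu>. transpose (a \<mu>) = - a \<mu>" "\<And>\<mu>. transpose (b \<mu>) = - b \<mu>"
    and \<kappa>: "0 < \<kappa>" "\<kappa> \<le> 1" "\<And>m n. {m, n} \<in> T \<Longrightarrow> \<kappa> \<le> \<bar>a (l {m, n}) $ m $ n\<bar>"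
    and \<beta>: "1 \<le> \<beta>" "\<And>\<mu> m n. \<bar>a \<mu> $ m $ n\<bar> \<le> \<beta> - 1" and d: "0 \<le> d" "d \<le> 1"
    and pure: "\<And>\<mu> m n. m < n \<Longrightarrow> \<bar>(a \<mu> $ m $ n)\<^sup>2 - (b \<mu> $ m $ n)\<^sup>2\<bar> \<le> d"
    and mixed: "\<And>\<mu> m n. m < n \<Longrightarrow> {m, n} \<in> T \<Longrightarrow> \<mu> \<noteq> l {m, n} \<Longrightarrow>
      \<bar>a (l {m, n}) $ m $ n * a \<mu> $ m $ n - b (l {m, n}) $ m $ n * b \<mu> $ m $ n\<bar> \<le> d"
    and cycles: "\<And>\<mu> p q. p < q \<Longrightarrow> {p, q} \<notin> T \<Longrightarrow>
      \<bar>edge_product (\<lambda>m n. a (l {m, n}) $ m $ n) (tree_path T p q) * a \<mu> $ q $ p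
        - edge_product (\<lambda>m n. b (l {m, n}) $ m $ n) (tree_path T p q) * b \<mu> $ q $ p\<bar> \<le> d"
  obtains s where "sign_vector s"
    "\<And>\<mu> m n. \<bar>a \<mu> $ m $ n - s $ m * b \<mu> $ m $ n * s $ n\<bar> \<le> gauge_const CARD('n) \<kappa> \<beta> * d"
proof -
  have sk: "a \<mu> $ n $ m = - a \<mu> $ m $ n" "b \<mu> $ n $ m = - b \<mu> $ m $ n" for \<mu> m n
    using arg_cong[OF skew(1)[of \<mu>], of "\<lambda>X. X $ m $ n"]
      arg_cong[OF skew(2)[of \<mu>], of "\<lambda>X. X $ m $ n"] by (simp_all add: transpose_def)
  have pure': "\<bar>(a \<mu> $ m $ n)\<^sup>2 - (b \<mu> $ m $ n)\<^sup>2\<bar> \<le> d" for \<mu> m n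
  proof -
    have "a \<mu> $ m $ m = 0" "b \<mu> $ m $ m = 0" using sk[of \<mu> m m] by auto
    then show ?thesis
      using pure[of m n \<mu>] pure[of n m \<mu>] sk[of \<mu> m n] d by (cases m n rule: linorder_cases) auto
  qed
  have mixed': "\<bar>a (l {m, n}) $ m $ n * a \<mu> $ m $ n - b (l {m, n}) $ m $ n * b \<mu> $ m $ n\<bar> \<le> d"
    if "{m, n} \<in> T" for \<mu> m n
  proof (cases "\<mu> = l {m, n}")
    case True
    then show ?thesis using pure'[of \<mu> m n] by (simp add: power2_eq_square)
  next
    case False
    have "m \<noteq> n" using T(3) that by auto
    then show ?thesis
      using mixed[of m n \<mu>] mixed[of n m \<mu>] sk[of _ m n] that False
      by (cases m n rule: linorder_cases) (auto simp: insert_commute)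
  qed
  have a\<beta>: "\<bar>a \<mu> $ m $ n\<bar> \<le> \<beta>" for \<mu> m n using \<beta>(2)[of \<mu> m n] by linarith
  have b\<beta>: "\<bar>b \<mu> $ m $ n\<bar> \<le> \<beta>" for \<mu> m n
  proof -
    have "(a \<mu> $ m $ n)\<^sup>2 \<le> (\<beta> - 1)\<^sup>2"
      using \<beta>(2)[of \<mu> m n] \<beta>(1) by (simp add: abs_le_square_iff[symmetric])
    then have "(b \<mu> $ m $ n)\<^sup>2 \<le> (\<beta> - 1)\<^sup>2 + 1" using pure'[of \<mu> m n] d by linarith
    also have "\<dots> \<le> \<beta>\<^sup>2" using \<beta>(1) by (simp add: power2_eq_square algebra_simps)
    finally show ?thesis using \<beta>(1) abs_le_square_iff[of "b \<mu> $ m $ n" \<beta>] by simp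
  qed
  \<comment> \<open>The sign by which the labelled entries differ; a vanishing product may get either sign.\<close>
  define \<sigma> where "\<sigma> m n = (if 0 \<le> a (l {m, n}) $ m $ n * b (l {m, n}) $ m $ n then 1 else - 1 :: real)" for m n
  have \<sigma>pm: "\<sigma> m n = 1 \<or> \<sigma> m n = - 1" for m n by (simp add: \<sigma>_def)
  have \<sigma>sym: "\<sigma> m n = \<sigma> n m" for m n
    unfolding \<sigma>_def using sk[of "l {m, n}" m n] by (simp add: insert_commute)
  obtain s0 where s0: "\<And>m. s0 m = 1 \<or> s0 m = -1" "\<And>m n. {m, n} \<in> T \<Longrightarrow> s0 m * s0 n = \<sigma> m n"
    using tree_signs_exist[where \<sigma> = \<sigma>, OF T \<sigma>pm \<sigma>sym] by auto
  define s :: "(real, 'n) vec" where "s = (\<chi> i. s0 i)"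
  have s: "sign_vector s" using s0 by (simp add: s_def sign_vector_def)
  define b' where "b' \<mu> m n = s $ m * b \<mu> $ m $ n * s $ n" for \<mu> m n
  have b'_alt: "b' \<mu> m n = (s $ m * s $ n) * b \<mu> $ m $ n" for \<mu> m n by (simp add: b'_def)
  have ss: "s $ m * s $ n = 1 \<or> s $ m * s $ n = -1" for m n
    using s unfolding sign_vector_def by (metis mult_1 mult_minus_left mult_minus_right minus_minus)
  have b'\<beta>: "\<bar>b' \<mu> m n\<bar> \<le> \<beta>" for \<mu> m n
    using b\<beta>[of \<mu> m n] by (simp add: b'_alt abs_mult sign_vector_abs[OF s])
  have b'2: "b' \<mu> m n * b' \<nu> m n = b \<mu> $ m $ n * b \<nu> $ m $ n" for \<mu> \<nu> m n
    using ss[of m n] by (auto simp: b'_alt)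
  let ?c1 = "(1 + \<beta> / \<kappa>) / \<kappa>" and ?c2 = "(1 + real CARD('n) * \<beta> ^ Suc CARD('n) / \<kappa>) / \<kappa> ^ CARD('n)"
  have c: "0 \<le> ?c1" "0 \<le> ?c2" using \<kappa> \<beta> by auto
  have label: "\<bar>a (l {m, n}) $ m $ n - b' (l {m, n}) m n\<bar> \<le> d / \<kappa>" if "{m, n} \<in> T" for m n
  proof (rule sq_close_same_sign)
    show "\<bar>(a (l {m, n}) $ m $ n)\<^sup>2 - (b' (l {m, n}) m n)\<^sup>2\<bar> \<le> d"
      using pure'[of "l {m, n}" m n] b'2[of "l {m, n}" m n "l {m, n}"] by (simp add: power2_eq_square)
    have "s $ m * s $ n = \<sigma> m n" using s0(2)[OF that] by (simp add: s_def)
    then show "0 \<le> a (l {m, n}) $ m $ n * b' (l {m, n}) m n"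
      by (auto simp: b'_alt \<sigma>_def)
  qed (use \<kappa> that in auto)
  have tree: "\<bar>a \<mu> $ m $ n - b' \<mu> m n\<bar> \<le> ?c1 * d" if "{m, n} \<in> T" for \<mu> m n
  proof -
    have "\<bar>a \<mu> $ m $ n - b' \<mu> m n\<bar> \<le> (d + (d / \<kappa>) * \<beta>) / \<kappa>"
      by (rule product_close_imp_factor_close[OF _ label[OF that] b'\<beta> \<kappa>(3)[OF that] \<kappa>(1)])
        (use mixed'[OF that] in \<open>simp add: b'2\<close>)
    then show ?thesis by (simp add: field_simps)
  qed
  have nontree: "\<bar>a \<mu> $ p $ q - b' \<mu> p q\<bar> \<le> ?c2 * d" if "p < q" "{p, q} \<notin> T" for \<mu> p q
  proof -
    let ?N = "CARD('n)" and ?vs = "tree_path T p q"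
    let ?Pa = "edge_product (\<lambda>m n. a (l {m, n}) $ m $ n) ?vs"
    let ?Pb = "edge_product (\<lambda>m n. b (l {m, n}) $ m $ n) ?vs"
    let ?Pb' = "edge_product (\<lambda>m n. b' (l {m, n}) m n) ?vs"
    have w: "walk T p ?vs q" "distinct ?vs" using tree_path_props[OF T(1,2)] by auto
    then have wT: "successively (\<lambda>m n. {m, n} \<in> T) ?vs" by (simp add: walk_def)
    have len: "length ?vs \<le> ?N" using w(2) by (metis distinct_card card_mono finite subset_UNIV)
    have gauge: "?Pb' = s $ p * ?Pb * s $ q" unfolding b'_def by (rule edge_product_gauge[OF s w(1)])
    \<comment> \<open>The closing entry contributes the two end signs a second time, so the cycle product is unchanged.\<close>
    have "?Pb' * b' \<mu> q p = (s $ p * s $ p) * (s $ q * s $ q) * (?Pb * b \<mu> $ q $ p)"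
      unfolding gauge unfolding b'_def by (simp add: algebra_simps)
    then have inv: "\<bar>?Pa * a \<mu> $ q $ p - ?Pb' * b' \<mu> q p\<bar> \<le> d"
      using cycles[OF that, of \<mu>] sign_vector_sq[OF s] by simp
    have "\<kappa> ^ length ?vs \<le> \<bar>?Pa\<bar>"
      by (rule edge_product_abs_bounds[where \<beta> = \<beta>], rule successively_mono[OF wT])
        (use \<kappa> a\<beta> \<beta>(1) in auto)
    then have low: "\<kappa> ^ ?N \<le> \<bar>?Pa\<bar>" using power_decreasing[OF len, of \<kappa>] \<kappa> by linarith
    have "\<bar>?Pa - ?Pb'\<bar> \<le> real (length ?vs) * \<beta> ^ length ?vs * (d / \<kappa>)"
      by (rule edge_product_diff_bound, rule successively_mono[OF wT])
        (use a\<beta> b'\<beta> \<beta>(1) label d \<kappa> in auto)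
    also have "\<dots> \<le> real ?N * \<beta> ^ ?N * (d / \<kappa>)"
      using len \<beta>(1) d \<kappa> by (intro mult_right_mono mult_mono power_increasing) auto
    finally have "\<bar>a \<mu> $ q $ p - b' \<mu> q p\<bar> \<le> (d + real ?N * \<beta> ^ ?N * (d / \<kappa>) * \<beta>) / \<kappa> ^ ?N"
      by (intro product_close_imp_factor_close[OF inv _ b'\<beta> low]) (use \<kappa> in auto)
    also have "\<dots> = ?c2 * d" using \<kappa> by (simp add: field_simps)
    finally have "\<bar>a \<mu> $ q $ p - b' \<mu> q p\<bar> \<le> ?c2 * d" .
    moreover have "a \<mu> $ q $ p - b' \<mu> q p = - (a \<mu> $ p $ q - b' \<mu> p q)"
      using sk[of \<mu> p q] by (simp add: b'_def)
    ultimately show ?thesis by simp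
  qed
  have main: "\<bar>a \<mu> $ m $ n - b' \<mu> m n\<bar> \<le> (?c1 + ?c2) * d" for \<mu> m n
  proof -
    have c1: "?c1 * d \<le> (?c1 + ?c2) * d" and c2: "?c2 * d \<le> (?c1 + ?c2) * d"
      using c d by (intro mult_right_mono; simp)+
    have swap: "\<bar>a \<mu> $ m $ n - b' \<mu> m n\<bar> = \<bar>a \<mu> $ n $ m - b' \<mu> n m\<bar>"
    proof -
      have "a \<mu> $ m $ n - b' \<mu> m n = - (a \<mu> $ n $ m - b' \<mu> n m)"
        using sk[of \<mu> n m] by (simp add: b'_def)
      then show ?thesis by (metis abs_minus_cancel)
    qed
    show ?thesis
    proof (cases "{m, n} \<in> T")
      case True
      then show ?thesis using tree c1 order_trans by blast
    next
      case False
      show ?thesis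
      proof (cases m n rule: linorder_cases)
        case less
        then show ?thesis using nontree False c2 order_trans by blast
      next
        case equal
        then show ?thesis using sk[of \<mu> m m] c d by (simp add: b'_def)
      next
        case greater
        then have "\<bar>a \<mu> $ n $ m - b' \<mu> n m\<bar> \<le> ?c2 * d"
          using nontree[of n m \<mu>] False by (simp add: insert_commute)
        then show ?thesis using c2 unfolding swap by linarith
      qed
    qed
  qed
  show thesis
    by (rule that[OF s]) (use main in \<open>simp add: gauge_const_def b'_def\<close>)
qed

section \<open>The intertwining matrix and its rate of change\<close>

text \<open>
  Only the coupling at the single point \<open>x\<close> is tied to the frame \<open>u\<close>; at another point of \<open>U\<close> the
  given coupling may belong to a frame with different signs.
\<close>
definition coupling_frame ::
  "(real^'m \<Rightarrow> 'n sq_matrix) \<Rightarrow> (real^'m \<Rightarrow> 'm \<Rightarrow> ('n::{finite,linorder}) sq_matrix) \<Rightarrow> real^'m \<Rightarrow>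
   (real^'m) set \<Rightarrow> (real^'m \<Rightarrow> 'n sq_matrix) \<Rightarrow> bool" where
  "coupling_frame H A x U u \<longleftrightarrow>
     open U \<and> x \<in> U \<and> C1_eigenframe_on U H u \<and> (\<forall>\<mu>. A x \<mu> = frame_coupling u x \<mu>)"

lemma derivative_coupling_frame:
  assumes "derivative_coupling X H A" "x \<in> X" "has_distinct_eigenvalues (H x)"
  obtains U u where "coupling_frame H A x U u"
  using assms unfolding derivative_coupling_def coupling_frame_def frame_coupling_def by metis

lemma coupling_frame_eigen:
  assumes "coupling_frame H A x U u"
  shows "orthogonal_matrix (u x)" "transpose (u x) ** H x ** u x = diag_matrix (ordered_eigenvalues (H x))"
  using assms unfolding coupling_frame_def C1_eigenframe_on_def by auto

lemma coupling_frame_C1: "coupling_frame H A x U u \<Longrightarrow> C1_on U u"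
  unfolding coupling_frame_def C1_eigenframe_on_def by auto

lemma coupling_frame_skew: "coupling_frame H A x U u \<Longrightarrow> transpose (A x \<mu>) = - A x \<mu>"
  using frame_coupling_skew[of U u x \<mu>] unfolding coupling_frame_def C1_eigenframe_on_def by auto

lemma coupling_frame_partial_deriv:
  assumes "coupling_frame H A x U u"
  shows "partial_deriv \<mu> u x = u x ** A x \<mu>"
proof -
  have "u x ** transpose (u x) = mat 1"
    using coupling_frame_eigen(1)[OF assms] by (simp add: orthogonal_matrix_def)
  then show ?thesis
    using assms by (simp add: coupling_frame_def frame_coupling_def matrix_mul_assoc)
qed

lemma coupling_frame_transition:
  assumes "coupling_frame H A x U u" "coupling_frame H A y V v" "y \<in> U"
  obtains t where "sign_vector t" "v y = u y ** diag_matrix t"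
    "\<And>\<mu>. A y \<mu> = diag_matrix t ** frame_coupling u y \<mu> ** diag_matrix t"
  using eigenframe_couplings_conjugate[of U V y H u v] assms unfolding coupling_frame_def by metis

text \<open>
  The coupling itself may jump by signs, but its norm is unaffected by them and agrees near \<open>x\<close> with
  that of the coupling of a fixed frame.
\<close>
lemma isCont_norm_coupling:
  assumes "derivative_coupling X H A" "nondegenerate_on X H" "open X" "x \<in> X"
  shows "isCont (\<lambda>y. norm (A y \<mu>)) x"
proof -
  have frame: "\<exists>U u. coupling_frame H A y U u" if "y \<in> X" for y
    using derivative_coupling_frame[OF assms(1) that] assms(2) that unfolding nondegenerate_on_def by metis
  obtain U u where u: "coupling_frame H A x U u" using frame assms(4) by blast
  then have U: "open U" "x \<in> U" unfolding coupling_frame_def by auto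
  have eq: "norm (frame_coupling u y \<mu>) = norm (A y \<mu>)" if y: "y \<in> X \<inter> U" for y
  proof -
    obtain V v where v: "coupling_frame H A y V v" using frame y by blast
    obtain t where "sign_vector t" "A y \<mu> = diag_matrix t ** frame_coupling u y \<mu> ** diag_matrix t"
      using coupling_frame_transition[OF u v] y by blast
    then show ?thesis
      by (simp add: norm_orthogonal_mult_left norm_orthogonal_mult_right orthogonal_diag_sign)
  qed
  have "isCont (\<lambda>y. norm (frame_coupling u y \<mu>)) x"
    by (intro isCont_norm isCont_frame_coupling[OF coupling_frame_C1[OF u]] U)
  moreover have "\<forall>\<^sub>F y in nhds x. norm (frame_coupling u y \<mu>) = norm (A y \<mu>)"
    unfolding eventually_nhds using U assms(3,4) eq by (intro exI[of _ "X \<inter> U"]) auto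
  ultimately show ?thesis by (rule iffD1[OF isCont_cong, rotated])
qed

text \<open>
  Near \<open>x\<close> the entries of \<open>a\<close> and \<open>b\<close> have hardly moved.  If the sign products at the ends of a tree
  edge differed between \<open>x\<close> and the nearby point, then the large entry of \<open>a\<close> on that edge would be
  closer than \<open>\<eta> + \<theta>\<close> to \<open>0\<close>.  So \<open>s\<close> and \<open>s'\<close> have the same quotient at the two ends of each edge, hence
  everywhere.
\<close>
lemma signs_rigid:
  fixes a b a' b' :: "'m \<Rightarrow> 'n::finite sq_matrix"
  assumes T: "graph_connected T" "\<And>m n. {m, n} \<in> T \<Longrightarrow> \<exists>\<mu>. \<kappa> \<le> \<bar>a \<mu> $ m $ n\<bar>"
    and s: "sign_vector s" "\<And>\<mu> m n. \<bar>a \<mu> $ m $ n - s $ m * b \<mu> $ m $ n * s $ n\<bar> \<le> \<eta>"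
    and s': "sign_vector s'" "\<And>\<mu> m n. \<bar>a' \<mu> $ m $ n - s' $ m * b' \<mu> $ m $ n * s' $ n\<bar> \<le> \<eta>"
    and near: "\<And>\<mu> m n. \<bar>a' \<mu> $ m $ n - a \<mu> $ m $ n\<bar> < \<theta>" "\<And>\<mu> m n. \<bar>b' \<mu> $ m $ n - b \<mu> $ m $ n\<bar> < \<theta>"
    and small: "\<eta> + \<theta> \<le> \<kappa>"
  shows "\<exists>\<tau>. (\<tau> = 1 \<or> \<tau> = - 1) \<and> s' = \<tau> *\<^sub>R s"
proof -
  have "s' $ m * s $ m = s' $ n * s $ n" if mn: "{m, n} \<in> T" for m n
  proof (rule ccontr)
    assume ne: "s' $ m * s $ m \<noteq> s' $ n * s $ n"
    obtain \<mu> where \<mu>: "\<kappa> \<le> \<bar>a \<mu> $ m $ n\<bar>" using T(2) mn by blast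
    have pm: "s $ m = 1 \<or> s $ m = -1" "s $ n = 1 \<or> s $ n = -1"
      "s' $ m = 1 \<or> s' $ m = -1" "s' $ n = 1 \<or> s' $ n = -1"
      using s s' unfolding sign_vector_def by auto
    then have "(s $ m * s $ n = 1 \<and> s' $ m * s' $ n = -1) \<or> (s $ m * s $ n = -1 \<and> s' $ m * s' $ n = 1)"
      using ne by auto
    moreover have "\<bar>a \<mu> $ m $ n - (s $ m * s $ n) * b \<mu> $ m $ n\<bar> \<le> \<eta>"
      "\<bar>a' \<mu> $ m $ n - (s' $ m * s' $ n) * b' \<mu> $ m $ n\<bar> \<le> \<eta>"
      using s(2)[of \<mu> m n] s'(2)[of \<mu> m n] by (simp_all add: ac_simps)
    ultimately show False
      using near[where \<mu> = \<mu> and m = m and n = n] \<mu> small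
      by auto
  qed
  then have const: "s' $ m * s $ m = s' $ n * s $ n" for m n
    by (rule connected_propagate[OF T(1), of "\<lambda>m. s' $ m * s $ m"])
  define \<tau> where "\<tau> = s' $ undefined * s $ undefined"
  have "s' $ m = \<tau> * s $ m" for m
    using const[of m undefined] sign_vector_sq[OF s(1), of m] unfolding \<tau>_def
    by (metis mult.assoc mult.right_neutral)
  moreover have "\<tau> = 1 \<or> \<tau> = -1"
    using s(1) s'(1) unfolding sign_vector_def \<tau>_def
    by (metis mult_1 mult_minus_left mult_minus_right minus_minus)
  ultimately show ?thesis by (intro exI[of _ \<tau>]) (simp add: vec_eq_iff)
qed

text \<open>
  The matrices \<open>u\<^sub>1 S u\<^sub>2\<^sup>T\<close> whose signs \<open>S\<close> match the couplings at \<open>x\<close> up to \<open>\<eta>\<close>.  No choice of frames is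
  made here: the values at different points become comparable only up to a sign, by
  \<open>signs_rigid\<close>.
\<close>
definition intertwines ::
  "(real^'m \<Rightarrow> 'n sq_matrix) \<Rightarrow> (real^'m \<Rightarrow> 'm \<Rightarrow> 'n sq_matrix) \<Rightarrow>
   (real^'m \<Rightarrow> 'n sq_matrix) \<Rightarrow> (real^'m \<Rightarrow> 'm \<Rightarrow> ('n::{finite,linorder}) sq_matrix) \<Rightarrow>
   real \<Rightarrow> real^'m \<Rightarrow> 'n sq_matrix \<Rightarrow> bool" where
  "intertwines H1 A1 H2 A2 \<eta> x W \<longleftrightarrow>
     (\<exists>U u V v s. coupling_frame H1 A1 x U u \<and> coupling_frame H2 A2 x V v \<and> sign_vector s \<and>
        (\<forall>\<mu> m n. \<bar>A1 x \<mu> $ m $ n - s $ m * A2 x \<mu> $ m $ n * s $ n\<bar> \<le> \<eta>) \<and>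
        W = u x ** diag_matrix s ** transpose (v x))"

text \<open>
  By skew symmetry the partial derivatives are \<open>u (A\<^sub>1 - S A\<^sub>2 S) S v\<^sup>T\<close>, and the orthogonal factors do not
  affect the norm.
\<close>
lemma intertwiner_derivative_bound:
  fixes u v :: "real^'m \<Rightarrow> ('n::{finite,linorder}) sq_matrix"
  assumes u: "coupling_frame H1 A1 x U u" and v: "coupling_frame H2 A2 x V v"
    and s: "sign_vector s" "\<And>\<mu> m n. \<bar>A1 x \<mu> $ m $ n - s $ m * A2 x \<mu> $ m $ n * s $ n\<bar> \<le> \<eta>"
  obtains D where
    "((\<lambda>y. u y ** diag_matrix s ** transpose (v y)) has_derivative D) (at x)"
    "\<And>h. norm (D h) \<le> real CARD('m) * (real CARD('n) * \<eta>) * norm h"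
proof -
  let ?S = "diag_matrix s"
  let ?u' = "frechet_derivative u (at x)" and ?v' = "frechet_derivative v (at x)"
  define D where "D h = (u x ** ?S) ** transpose (?v' h) + (?u' h ** ?S) ** transpose (v x)" for h
  have x: "x \<in> U" "x \<in> V" using u v unfolding coupling_frame_def by auto
  have du: "((\<lambda>y. u y ** ?S) has_derivative (\<lambda>h. ?u' h ** ?S)) (at x)"
    by (rule bounded_linear.has_derivative[OF bounded_bilinear.bounded_linear_left[OF
          bounded_bilinear_matrix_mult] C1_on_has_derivative[OF coupling_frame_C1[OF u] x(1)]])
  have dv: "((\<lambda>y. transpose (v y)) has_derivative (\<lambda>h. transpose (?v' h))) (at x)"
    by (rule bounded_linear.has_derivative[OF bounded_linear_transpose
          C1_on_has_derivative[OF coupling_frame_C1[OF v] x(2)]])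
  have deriv: "((\<lambda>y. u y ** ?S ** transpose (v y)) has_derivative D) (at x)"
    unfolding D_def by (rule bounded_bilinear.FDERIV[OF bounded_bilinear_matrix_mult du dv])
  interpret D: linear D using deriv has_derivative_linear by blast
  have partial: "norm (D (axis \<mu> 1)) \<le> real CARD('n) * \<eta>" for \<mu>
  proof -
    let ?E = "A1 x \<mu> - ?S ** A2 x \<mu> ** ?S"
    have u': "?u' (axis \<mu> 1) = u x ** A1 x \<mu>"
      using coupling_frame_partial_deriv[OF u] by (simp add: partial_deriv_def)
    have "?v' (axis \<mu> 1) = v x ** A2 x \<mu>"
      using coupling_frame_partial_deriv[OF v] by (simp add: partial_deriv_def)
    then have v': "transpose (?v' (axis \<mu> 1)) = - (A2 x \<mu> ** transpose (v x))"
      by (simp add: matrix_transpose_mul coupling_frame_skew[OF v]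
          bounded_bilinear.minus_left[OF bounded_bilinear_matrix_mult])
    have "D (axis \<mu> 1) = u x ** A1 x \<mu> ** ?S ** transpose (v x) - u x ** ?S ** A2 x \<mu> ** transpose (v x)"
      unfolding D_def u' v'
      by (simp add: matrix_mul_assoc bounded_bilinear.minus_right[OF bounded_bilinear_matrix_mult])
    also have "\<dots> = u x ** (?E ** ?S) ** transpose (v x)"
      using diag_sign_sq[OF s(1)]
      by (simp add: matrix_mult_diff_left matrix_mult_diff_right flip: matrix_mul_assoc)
    finally have "norm (D (axis \<mu> 1)) = norm ?E"
      using coupling_frame_eigen(1)[OF u] coupling_frame_eigen(1)[OF v] s(1)
      by (simp add: norm_orthogonal_mult_left norm_orthogonal_mult_right orthogonal_diag_sign
          orthogonal_matrix_transpose_self)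
    also have "\<dots> \<le> real CARD('n) * \<eta>"
      by (rule norm_le_if_entries_le) (use s(2) in \<open>simp add: diag_mult_entry mult_diag_entry\<close>)
    finally show ?thesis .
  qed
  have "norm (D h) \<le> real CARD('m) * (real CARD('n) * \<eta>) * norm h" for h
  proof -
    have "h = (\<Sum>\<mu>\<in>UNIV. h $ \<mu> *\<^sub>R axis \<mu> 1)"
      by (metis (no_types) basis_expansion scalar_mult_eq_scaleR)
    then have "D h = D (\<Sum>\<mu>\<in>UNIV. h $ \<mu> *\<^sub>R axis \<mu> 1)" by simp
    then have "D h = (\<Sum>\<mu>\<in>UNIV. h $ \<mu> *\<^sub>R D (axis \<mu> 1))" by (simp add: D.sum D.scale)
    also have "norm \<dots> \<le> (\<Sum>\<mu>\<in>(UNIV::'m set). norm h * (real CARD('n) * \<eta>))"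
      by (intro sum_norm_le) (simp add: mult_mono component_le_norm_cart partial)
    finally show ?thesis by (simp add: algebra_simps)
  qed
  then show thesis using that deriv by blast
qed

text \<open>
  Extend the frames at \<open>x\<close> with fixed signs to a differentiable \<open>F\<close>, to which the derivative bound
  applies.  An intertwining matrix \<open>W'\<close> at a nearby point \<open>y\<close> may come from other frames and another sign
  choice, but rewriting it in the frames of \<open>F\<close> only changes its signs, and rigidity gives
  \<open>W' = \<plusminus>F y\<close>.
\<close>
lemma intertwiner_locally_lipschitz:
  fixes H1 H2 :: "real^'m \<Rightarrow> ('n::{finite,linorder}) sq_matrix"
  assumes W: "intertwines H1 A1 H2 A2 \<eta> x W"
    and T: "graph_connected T" "\<And>m n. {m, n} \<in> T \<Longrightarrow> \<exists>\<mu>. \<kappa> \<le> \<bar>A1 x \<mu> $ m $ n\<bar>"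
    and "\<eta> < \<kappa>" "0 < \<epsilon>"
  shows "\<exists>\<delta>>0. \<forall>y W'. dist y x < \<delta> \<longrightarrow> intertwines H1 A1 H2 A2 \<eta> y W' \<longrightarrow>
    (\<exists>\<tau>. (\<tau> = 1 \<or> \<tau> = - 1) \<and>
      norm (W' - \<tau> *\<^sub>R W) \<le> (real CARD('m) * (real CARD('n) * \<eta>) + \<epsilon>) * dist y x)"
proof -
  let ?c = "real CARD('m) * (real CARD('n) * \<eta>)"
  obtain U u V v s where u: "coupling_frame H1 A1 x U u" and v: "coupling_frame H2 A2 x V v"
    and s: "sign_vector s" "\<And>\<mu> m n. \<bar>A1 x \<mu> $ m $ n - s $ m * A2 x \<mu> $ m $ n * s $ n\<bar> \<le> \<eta>"
    and W: "W = u x ** diag_matrix s ** transpose (v x)"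
    using W unfolding intertwines_def by blast
  define F where "F y = u y ** diag_matrix s ** transpose (v y)" for y
  obtain D where D: "(F has_derivative D) (at x)" "\<And>h. norm (D h) \<le> ?c * norm h"
    using intertwiner_derivative_bound[OF u v s] unfolding F_def by blast
  have x: "x \<in> U" "x \<in> V" "open U" "open V" using u v unfolding coupling_frame_def by auto
  have A: "frame_coupling u x \<mu> = A1 x \<mu>" "frame_coupling v x \<mu> = A2 x \<mu>" for \<mu>
    using u v unfolding coupling_frame_def by auto
  obtain \<delta>1 where \<delta>1: "0 < \<delta>1"
    "\<And>y. norm (y - x) < \<delta>1 \<Longrightarrow> norm (F y - F x - D (y - x)) \<le> \<epsilon> * norm (y - x)"
    using D(1) \<open>0 < \<epsilon>\<close> unfolding has_derivative_at_alt by blast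
  have F: "norm (F y - F x) \<le> (?c + \<epsilon>) * dist y x" if "dist y x < \<delta>1" for y
    using \<delta>1(2)[of y] D(2)[of "y - x"] norm_triangle_ineq2[of "F y - F x" "D (y - x)"] that
    by (simp add: dist_norm distrib_right)
  have near: "\<forall>\<^sub>F y in nhds x. \<forall>\<mu>. dist (frame_coupling w y \<mu>) (frame_coupling w x \<mu>) < \<kappa> - \<eta>"
    if "C1_on O' w" "open O'" "x \<in> O'" for w :: "real^'m \<Rightarrow> 'n sq_matrix" and O'
  proof (rule eventually_all_finite)
    fix \<mu>
    have "((\<lambda>y. frame_coupling w y \<mu>) \<longlongrightarrow> frame_coupling w x \<mu>) (nhds x)"
      using isCont_frame_coupling[OF that, of \<mu>]
        tendsto_at_iff_tendsto_nhds[of "\<lambda>y. frame_coupling w y \<mu>" x] by (simp add: isCont_def)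
    then show "\<forall>\<^sub>F y in nhds x. dist (frame_coupling w y \<mu>) (frame_coupling w x \<mu>) < \<kappa> - \<eta>"
      using \<open>\<eta> < \<kappa>\<close> by (intro tendstoD) auto
  qed
  have "\<forall>\<^sub>F y in nhds x. y \<in> U \<and> y \<in> V \<and> dist y x < \<delta>1 \<and>
      (\<forall>\<mu>. dist (frame_coupling u y \<mu>) (frame_coupling u x \<mu>) < \<kappa> - \<eta>) \<and>
      (\<forall>\<mu>. dist (frame_coupling v y \<mu>) (frame_coupling v x \<mu>) < \<kappa> - \<eta>)"
    using near[OF coupling_frame_C1[OF u] x(3,1)] near[OF coupling_frame_C1[OF v] x(4,2)]
      eventually_nhds_in_open[OF x(3,1)] eventually_nhds_in_open[OF x(4,2)] \<delta>1(1)
    by (intro eventually_conj) (auto simp: eventually_nhds_metric)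
  then obtain \<delta> where \<delta>: "0 < \<delta>" and y_near: "\<And>y. dist y x < \<delta> \<Longrightarrow> y \<in> U \<and> y \<in> V \<and> dist y x < \<delta>1 \<and>
      (\<forall>\<mu>. dist (frame_coupling u y \<mu>) (frame_coupling u x \<mu>) < \<kappa> - \<eta>) \<and>
      (\<forall>\<mu>. dist (frame_coupling v y \<mu>) (frame_coupling v x \<mu>) < \<kappa> - \<eta>)"
    unfolding eventually_nhds_metric by blast
  have "\<exists>\<tau>. (\<tau> = 1 \<or> \<tau> = - 1) \<and> norm (W' - \<tau> *\<^sub>R W) \<le> (?c + \<epsilon>) * dist y x"
    if y: "dist y x < \<delta>" and W': "intertwines H1 A1 H2 A2 \<eta> y W'" for y W'
  proof -
    note yn = y_near[OF y]
    obtain U' u' V' v' s' where u': "coupling_frame H1 A1 y U' u'" and v': "coupling_frame H2 A2 y V' v'"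
      and s': "sign_vector s'" "\<And>\<mu> m n. \<bar>A1 y \<mu> $ m $ n - s' $ m * A2 y \<mu> $ m $ n * s' $ n\<bar> \<le> \<eta>"
      and W': "W' = u' y ** diag_matrix s' ** transpose (v' y)"
      using W' unfolding intertwines_def by blast
    obtain p where p: "sign_vector p" "u' y = u y ** diag_matrix p"
      "\<And>\<mu>. A1 y \<mu> = diag_matrix p ** frame_coupling u y \<mu> ** diag_matrix p"
      using coupling_frame_transition[OF u u'] yn by metis
    obtain q where q: "sign_vector q" "v' y = v y ** diag_matrix q"
      "\<And>\<mu>. A2 y \<mu> = diag_matrix q ** frame_coupling v y \<mu> ** diag_matrix q"
      using coupling_frame_transition[OF v v'] yn by metis
    define t where "t = (\<chi> i. p $ i * s' $ i * q $ i)"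
    have t: "sign_vector t"
      unfolding sign_vector_def t_def
    proof
      fix i
      show "(\<chi> i. p $ i * s' $ i * q $ i) $ i = 1 \<or> (\<chi> i. p $ i * s' $ i * q $ i) $ i = - 1"
        using p(1) q(1) s'(1) unfolding sign_vector_def by (auto dest!: spec[of _ i])
    qed
    have "W' = u y ** (diag_matrix p ** diag_matrix s' ** diag_matrix q) ** transpose (v y)"
      unfolding W' p(2) q(2) by (simp add: matrix_transpose_mul transpose_diag matrix_mul_assoc)
    then have W't: "W' = u y ** diag_matrix t ** transpose (v y)"
      by (simp add: diag_mult_diag t_def)
    have close: "\<bar>frame_coupling u y \<mu> $ m $ n - t $ m * frame_coupling v y \<mu> $ m $ n * t $ n\<bar> \<le> \<eta>"
      for \<mu> m n
    proof -
      \<comment> \<open>The transition signs of the first frame are moved to the other side; the second summand vanishes because signs square to one.\<close>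
      have "A1 y \<mu> $ m $ n - s' $ m * A2 y \<mu> $ m $ n * s' $ n = (p $ m * p $ n) *
          ((p $ m * p $ m) * (p $ n * p $ n) * frame_coupling u y \<mu> $ m $ n
            - t $ m * frame_coupling v y \<mu> $ m $ n * t $ n)
          + (1 - (p $ m * p $ m) * (p $ n * p $ n)) * (A1 y \<mu> $ m $ n - s' $ m * A2 y \<mu> $ m $ n * s' $ n)"
        unfolding p(3) q(3) t_def by (simp add: diag_mult_entry mult_diag_entry algebra_simps)
      then have "\<bar>A1 y \<mu> $ m $ n - s' $ m * A2 y \<mu> $ m $ n * s' $ n\<bar>
          = \<bar>frame_coupling u y \<mu> $ m $ n - t $ m * frame_coupling v y \<mu> $ m $ n * t $ n\<bar>"
        by (simp add: sign_vector_sq[OF p(1)] sign_vector_abs[OF p(1)] abs_mult)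
      then show ?thesis using s'(2)[of \<mu> m n] by simp
    qed
    have entry: "\<bar>X $ m $ n - Y $ m $ n\<bar> < r" if "dist X Y < r" for X Y :: "'n sq_matrix" and m n r
      using entry_le_norm[of "X - Y" m n] that by (simp add: dist_norm)
    obtain \<tau> where \<tau>: "\<tau> = 1 \<or> \<tau> = - 1" "t = \<tau> *\<^sub>R s"
      using signs_rigid[where a = "A1 x" and b = "A2 x" and a' = "frame_coupling u y"
          and b' = "frame_coupling v y" and \<theta> = "\<kappa> - \<eta>", OF T s t close]
        yn A entry by auto
    have "diag_matrix t = \<tau> *\<^sub>R diag_matrix s"
      unfolding \<tau>(2) by (simp add: diag_matrix_def vec_eq_iff)
    then have "W' = \<tau> *\<^sub>R F y"
      unfolding W't F_def by (simp add: matrix_scalar_ac scalar_matrix_assoc)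
    then have "W' - \<tau> *\<^sub>R W = \<tau> *\<^sub>R (F y - F x)"
      unfolding W F_def by (simp add: scaleR_diff_right)
    then have "norm (W' - \<tau> *\<^sub>R W) = norm (F y - F x)" using \<tau>(1) by auto
    then show ?thesis using F[of y] yn \<tau>(1) by auto
  qed
  then show ?thesis using \<delta> by blast
qed

section \<open>Following the intertwining matrix along a path\<close>

fun polygon_length :: "'a::metric_space list \<Rightarrow> real" where
  "polygon_length (a # b # xs) = dist a b + polygon_length (b # xs)"
| "polygon_length _ = 0"

lemma polygon_length_nonneg: "0 \<le> polygon_length xs"
  by (induction xs rule: polygon_length.induct) auto

lemma polygon_length_append:
  "polygon_length (xs @ [b]) + polygon_length (b # ys) = polygon_length (xs @ b # ys)"
  by (induction xs rule: polygon_length.induct) auto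

lemma sum_dist_eq_polygon_length:
  "(\<Sum>i<length ts - 1. ennreal (dist (\<gamma> (ts ! i)) (\<gamma> (ts ! Suc i)))) = ennreal (polygon_length (map \<gamma> ts))"
  by (induction ts rule: induct_list012)
    (simp_all add: sum.lessThan_Suc_shift polygon_length_nonneg del: sum.lessThan_Suc)

lemma polygon_length_le:
  assumes "path_length \<gamma> \<le> ennreal L" "0 \<le> L" "sorted ts" "set ts \<subseteq> {0..1}"
  shows "polygon_length (map \<gamma> ts) \<le> L"
proof -
  have "ennreal (polygon_length (map \<gamma> ts)) \<le> path_length \<gamma>"
    unfolding path_length_def sum_dist_eq_polygon_length
    by (rule SUP_upper) (use assms in auto)
  then show ?thesis using assms by (metis ennreal_le_iff order_trans)
qed

text \<open>
  Comparison up to sign is transitive, so an interval bisection argument extends the local estimate to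
  the whole parameter interval; the distances add up to the length of an inscribed polygon.
\<close>
lemma lipschitz_up_to_sign_along_path:
  fixes \<gamma> :: "real \<Rightarrow> 'a::metric_space" and W :: "'a \<Rightarrow> 'b::real_normed_vector"
  assumes "path \<gamma>" "path_image \<gamma> \<subseteq> K" "path_length \<gamma> \<le> ennreal L" "0 \<le> L" "0 \<le> c"
    and local: "\<And>x. x \<in> K \<Longrightarrow> \<exists>\<delta>>0. \<forall>y\<in>K. dist y x < \<delta> \<longrightarrow>
      (\<exists>\<tau>. (\<tau> = 1 \<or> \<tau> = - 1) \<and> norm (W y - \<tau> *\<^sub>R W x) \<le> c * dist y x)"
  shows "\<exists>\<tau>. (\<tau> = 1 \<or> \<tau> = - 1) \<and> norm (W (pathfinish \<gamma>) - \<tau> *\<^sub>R W (pathstart \<gamma>)) \<le> c * L"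
proof -
  define P where "P a b \<longleftrightarrow> (0 \<le> a \<and> b \<le> 1 \<longrightarrow> (\<exists>ts \<tau>. sorted (a # ts @ [b]) \<and> (\<tau> = 1 \<or> \<tau> = - 1) \<and>
      norm (W (\<gamma> b) - \<tau> *\<^sub>R W (\<gamma> a)) \<le> c * polygon_length (map \<gamma> (a # ts @ [b]))))" for a b
  have compose: "norm (z - (\<sigma> * \<tau>) *\<^sub>R x) \<le> e + d"
    if "norm (y - \<tau> *\<^sub>R x) \<le> d" "norm (z - \<sigma> *\<^sub>R y) \<le> e" "\<sigma> = 1 \<or> \<sigma> = - 1"
    for x y z :: 'b and \<sigma> \<tau> d e
  proof -
    have "z - (\<sigma> * \<tau>) *\<^sub>R x = (z - \<sigma> *\<^sub>R y) + \<sigma> *\<^sub>R (y - \<tau> *\<^sub>R x)"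
      by (simp add: scaleR_diff_right)
    also have "norm \<dots> \<le> norm (z - \<sigma> *\<^sub>R y) + norm (\<sigma> *\<^sub>R (y - \<tau> *\<^sub>R x))" by (rule norm_triangle_ineq)
    also have "norm (\<sigma> *\<^sub>R (y - \<tau> *\<^sub>R x)) = norm (y - \<tau> *\<^sub>R x)" using that(3) by auto
    finally show ?thesis using that by linarith
  qed
  have "P 0 1"
  proof (rule Bolzano)
    show "P a d" if Pab: "P a b" and Pbd: "P b d" and abd: "a \<le> b" "b \<le> d" for a b d
      unfolding P_def
    proof
      assume "0 \<le> a \<and> d \<le> 1"
      then have "0 \<le> a" "b \<le> 1" "0 \<le> b" "d \<le> 1" using abd by auto
      obtain ts \<tau> where ts: "sorted (a # ts @ [b])" "\<tau> = 1 \<or> \<tau> = - 1"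
          "norm (W (\<gamma> b) - \<tau> *\<^sub>R W (\<gamma> a)) \<le> c * polygon_length (map \<gamma> (a # ts @ [b]))"
        using Pab \<open>0 \<le> a\<close> \<open>b \<le> 1\<close> unfolding P_def by blast
      obtain us \<sigma> where us: "sorted (b # us @ [d])" "\<sigma> = 1 \<or> \<sigma> = - 1"
          "norm (W (\<gamma> d) - \<sigma> *\<^sub>R W (\<gamma> b)) \<le> c * polygon_length (map \<gamma> (b # us @ [d]))"
        using Pbd \<open>0 \<le> b\<close> \<open>d \<le> 1\<close> unfolding P_def by blast
      have "polygon_length (map \<gamma> (a # ts @ [b])) + polygon_length (map \<gamma> (b # us @ [d]))
          = polygon_length (map \<gamma> (a # (ts @ b # us) @ [d]))"
        using polygon_length_append[of "map \<gamma> (a # ts)" "\<gamma> b" "map \<gamma> (us @ [d])"] by simp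
      moreover have "norm (W (\<gamma> d) - (\<sigma> * \<tau>) *\<^sub>R W (\<gamma> a)) \<le>
          c * polygon_length (map \<gamma> (b # us @ [d])) + c * polygon_length (map \<gamma> (a # ts @ [b]))"
        by (rule compose[OF ts(3) us(3) us(2)])
      ultimately have "norm (W (\<gamma> d) - (\<sigma> * \<tau>) *\<^sub>R W (\<gamma> a))
          \<le> c * polygon_length (map \<gamma> (a # (ts @ b # us) @ [d]))"
        by (metis add.commute distrib_left)
      moreover have "sorted (a # (ts @ b # us) @ [d])"
        using ts(1) us(1) by (fastforce simp: sorted_append)
      moreover have "\<sigma> * \<tau> = 1 \<or> \<sigma> * \<tau> = - 1" using ts us by auto
      ultimately show "\<exists>ts \<tau>. sorted (a # ts @ [d]) \<and> (\<tau> = 1 \<or> \<tau> = - 1) \<and>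
          norm (W (\<gamma> d) - \<tau> *\<^sub>R W (\<gamma> a)) \<le> c * polygon_length (map \<gamma> (a # ts @ [d]))"
        by (intro exI[of _ "ts @ b # us"] exI[of _ "\<sigma> * \<tau>"]) blast
    qed
    show "\<exists>d>0. \<forall>a b. a \<le> x \<and> x \<le> b \<and> b - a < d \<longrightarrow> P a b" if x: "0 \<le> x" "x \<le> 1" for x
    proof -
      have K: "\<gamma> t \<in> K" if "0 \<le> t" "t \<le> 1" for t
        using that assms(2) unfolding path_image_def by auto
      obtain \<delta> where \<delta>: "0 < \<delta>" "\<And>y. y \<in> K \<Longrightarrow> dist y (\<gamma> x) < \<delta> \<Longrightarrow>
          \<exists>\<tau>. (\<tau> = 1 \<or> \<tau> = - 1) \<and> norm (W y - \<tau> *\<^sub>R W (\<gamma> x)) \<le> c * dist y (\<gamma> x)"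
        using local[OF K[OF x]] by blast
      obtain d where d: "0 < d" "\<And>t. 0 \<le> t \<Longrightarrow> t \<le> 1 \<Longrightarrow> dist t x < d \<Longrightarrow> dist (\<gamma> t) (\<gamma> x) < \<delta>"
        using assms(1) x \<delta>(1) unfolding path_def continuous_on_iff by (meson atLeastAtMost_iff)
      have "P a b" if ab: "a \<le> x" "x \<le> b" "b - a < d" for a b
        unfolding P_def
      proof
        assume "0 \<le> a \<and> b \<le> 1"
        then have "0 \<le> a" "a \<le> 1" "0 \<le> b" "b \<le> 1" "dist a x < d" "dist b x < d"
          using ab x by (auto simp: dist_real_def)
        then obtain \<sigma> \<tau> where \<sigma>: "\<sigma> = 1 \<or> \<sigma> = - 1"
            "norm (W (\<gamma> a) - \<sigma> *\<^sub>R W (\<gamma> x)) \<le> c * dist (\<gamma> a) (\<gamma> x)"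
          and \<tau>: "\<tau> = 1 \<or> \<tau> = - 1" "norm (W (\<gamma> b) - \<tau> *\<^sub>R W (\<gamma> x)) \<le> c * dist (\<gamma> b) (\<gamma> x)"
          using \<delta>(2) d(2) K by metis
        have "norm (W (\<gamma> x) - \<sigma> *\<^sub>R W (\<gamma> a)) = norm (W (\<gamma> a) - \<sigma> *\<^sub>R W (\<gamma> x))"
          using \<sigma>(1) by (auto simp: norm_minus_commute add.commute)
        with \<sigma>(2) have "norm (W (\<gamma> x) - \<sigma> *\<^sub>R W (\<gamma> a)) \<le> c * dist (\<gamma> a) (\<gamma> x)" by simp
        from compose[OF this \<tau>(2,1)]
        have "norm (W (\<gamma> b) - (\<tau> * \<sigma>) *\<^sub>R W (\<gamma> a)) \<le> c * polygon_length (map \<gamma> (a # [x] @ [b]))"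
          by (simp add: dist_commute algebra_simps)
        moreover have "\<tau> * \<sigma> = 1 \<or> \<tau> * \<sigma> = - 1" using \<sigma> \<tau> by auto
        ultimately show "\<exists>ts \<tau>. sorted (a # ts @ [b]) \<and> (\<tau> = 1 \<or> \<tau> = - 1) \<and>
            norm (W (\<gamma> b) - \<tau> *\<^sub>R W (\<gamma> a)) \<le> c * polygon_length (map \<gamma> (a # ts @ [b]))"
          using ab by (intro exI[of _ "[x]"] exI[of _ "\<tau> * \<sigma>"]) auto
      qed
      then show ?thesis using d(1) by blast
    qed
  qed simp
  then obtain ts \<tau> where ts: "sorted (0 # ts @ [1])" "\<tau> = 1 \<or> \<tau> = - 1"
    "norm (W (\<gamma> 1) - \<tau> *\<^sub>R W (\<gamma> 0)) \<le> c * polygon_length (map \<gamma> (0 # ts @ [1]))"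
    unfolding P_def by auto
  have "polygon_length (map \<gamma> (0 # ts @ [1])) \<le> L"
    by (rule polygon_length_le[OF assms(3,4) ts(1)]) (use ts(1) in \<open>auto simp: sorted_append\<close>)
  then have "c * polygon_length (map \<gamma> (0 # ts @ [1])) \<le> c * L" using assms(5) by (rule mult_left_mono)
  then have "norm (W (\<gamma> 1) - \<tau> *\<^sub>R W (\<gamma> 0)) \<le> c * L" using ts(3) by linarith
  with ts(2) show ?thesis unfolding pathfinish_def pathstart_def by blast
qed

section \<open>The stability estimate\<close>

lemma isCont_C1_family: "C1_symmetric_family X H \<Longrightarrow> x \<in> X \<Longrightarrow> isCont H x"
  unfolding C1_symmetric_family_def using C1_on_isCont by blast

lemma SUP_compact_finite:
  fixes f :: "'a::metric_space \<Rightarrow> real"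
  assumes "compact K" "\<And>x. x \<in> K \<Longrightarrow> isCont f x"
  shows "(SUP x\<in>K. ennreal (f x)) < \<infinity>"
proof -
  have "continuous_on K f" using assms(2) by (simp add: continuous_at_imp_continuous_on)
  then have "bounded (f ` K)" using assms(1) compact_continuous_image compact_imp_bounded by blast
  then obtain b where "\<And>x. x \<in> K \<Longrightarrow> f x \<le> b"
    unfolding bounded_real by (metis abs_le_D1 imageI)
  then have "(SUP x\<in>K. ennreal (f x)) \<le> ennreal b" by (auto intro!: SUP_least ennreal_leI)
  then show ?thesis by (rule le_less_trans) simp
qed

lemma bound_modulus_finite:
  fixes H :: "real^'m \<Rightarrow> ('n::{finite,linorder}) sq_matrix"
  assumes "C1_symmetric_family X H" "nondegenerate_on X H" "derivative_coupling X H A" "open X"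
    "compact K" "K \<subseteq> X"
  shows "bound_modulus K H A < \<infinity>"
proof -
  have "(SUP x\<in>K. ennreal (norm (H x))) < \<infinity>"
    by (rule SUP_compact_finite[OF assms(5)], rule isCont_norm, rule isCont_C1_family[OF assms(1)])
      (use assms(6) in auto)
  moreover have "(SUP x\<in>K. ennreal (norm (A x \<mu>))) < \<infinity>" for \<mu>
    by (rule SUP_compact_finite[OF assms(5)], rule isCont_norm_coupling[OF assms(3,2,4)])
      (use assms(6) in auto)
  ultimately show ?thesis unfolding bound_modulus_def by simp
qed

lemma bound_modulus_le:
  assumes "bound_modulus K H A = B" "B < \<infinity>" "x \<in> K"
  shows "norm (H x) \<le> enn2real B" "norm (A x \<mu>) \<le> enn2real B"
proof -
  have "ennreal (norm (H x)) \<le> (SUP x\<in>K. ennreal (norm (H x)))" by (rule SUP_upper[OF assms(3)])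
  also have "\<dots> \<le> B"
    unfolding assms(1)[symmetric] bound_modulus_def by (rule add_increasing2[OF zero_le order_refl])
  finally have "ennreal (norm (H x)) \<le> B" .
  from enn2real_mono[OF this] show "norm (H x) \<le> enn2real B" using assms(2) by simp
  have "ennreal (norm (A x \<mu>)) \<le> (SUP x\<in>K. ennreal (norm (A x \<mu>)))" by (rule SUP_upper[OF assms(3)])
  also have "\<dots> \<le> (MAX \<mu>\<in>UNIV. SUP x\<in>K. ennreal (norm (A x \<mu>)))" by (rule Max_ge) auto
  also have "\<dots> \<le> B"
    unfolding assms(1)[symmetric] bound_modulus_def by (rule add_increasing[OF zero_le order_refl])
  finally have "ennreal (norm (A x \<mu>)) \<le> B" .
  from enn2real_mono[OF this] show "norm (A x \<mu>) \<le> enn2real B" using assms(2) by simp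
qed

text \<open>
  Replacing \<open>Q\<close> by \<open>\<tau> Q\<close> does not change the conjugate, so only the distance up to sign enters.
\<close>
lemma conjugation_diff_le:
  fixes W Q H :: "real^'n^'n"
  assumes "orthogonal_matrix W" "orthogonal_matrix Q" "\<tau> = 1 \<or> \<tau> = - 1"
  shows "norm (transpose W ** H ** W - transpose Q ** H ** Q) \<le> 2 * norm H * norm (W - \<tau> *\<^sub>R Q)"
proof -
  define R where "R = \<tau> *\<^sub>R Q"
  have \<tau>: "\<tau> * \<tau> = 1" "\<bar>\<tau>\<bar> = 1" using assms(3) by auto
  have R: "transpose R ** H ** R = transpose Q ** H ** Q"
    unfolding R_def by (simp add: transpose_scalar matrix_scalar_ac \<tau> flip: scalar_matrix_assoc)
  have R2: "norm (X ** R) = norm X" for X :: "real^'n^'n"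
    unfolding R_def using assms(2) \<tau>
    by (simp add: matrix_scalar_ac norm_orthogonal_mult_right flip: scalar_matrix_assoc)
  have "transpose W ** H ** W - transpose R ** H ** R
      = transpose W ** (H ** (W - R)) + (transpose (W - R) ** H) ** R"
    by (simp add: matrix_mult_diff_left matrix_mult_diff_right matrix_mul_assoc
        linear_diff[OF bounded_linear.linear[OF bounded_linear_transpose]])
  also have "norm \<dots> \<le> norm (H ** (W - R)) + norm (transpose (W - R) ** H)"
    by (rule order_trans[OF norm_triangle_ineq])
      (simp add: R2 norm_orthogonal_mult_left orthogonal_matrix_transpose_self assms(1))
  also have "\<dots> \<le> norm H * norm (W - R) + norm (transpose (W - R)) * norm H"
    by (intro add_mono norm_matrix_mult_le)
  finally show ?thesis unfolding R by (simp add: norm_transpose R_def)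
qed

text \<open>
  In the frame \<open>v\<close> of \<open>H2 x\<close> both matrices are diagonal, as the signs commute with the diagonal
  matrix of eigenvalues.
\<close>
lemma intertwiner_conjugates:
  fixes H1 H2 :: "real^'m \<Rightarrow> ('n::{finite,linorder}) sq_matrix"
  assumes "intertwines H1 A1 H2 A2 \<eta> x W"
    and ev: "\<And>i. \<bar>ordered_eigenvalues (H1 x) $ i - ordered_eigenvalues (H2 x) $ i\<bar> \<le> d" and "0 \<le> d"
  shows "orthogonal_matrix W" "norm (H2 x - transpose W ** H1 x ** W) \<le> real CARD('n) * d"
proof -
  obtain U u V v s where u: "coupling_frame H1 A1 x U u" and v: "coupling_frame H2 A2 x V v"
    and s: "sign_vector s" and W: "W = u x ** diag_matrix s ** transpose (v x)"
    using assms(1) unfolding intertwines_def by blast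
  note ou = coupling_frame_eigen[OF u] and ov = coupling_frame_eigen[OF v]
  let ?S = "diag_matrix s" and ?e1 = "diag_matrix (ordered_eigenvalues (H1 x))"
    and ?e2 = "diag_matrix (ordered_eigenvalues (H2 x))"
  show "orthogonal_matrix W"
    unfolding W by (intro orthogonal_matrix_mul) (simp_all add: ou ov orthogonal_diag_sign s orthogonal_matrix_transpose_self)
  have vv: "v x ** transpose (v x) = mat 1" using ov(1) by (simp add: orthogonal_matrix_def)
  have "?S ** ?e1 ** ?S = ?S ** ?S ** ?e1"
    by (simp add: vec_eq_iff diag_mult_entry mult_diag_entry flip: matrix_mul_assoc)
      (simp add: diag_matrix_def)
  then have SeS: "?S ** ?e1 ** ?S = ?e1" by (simp add: diag_sign_sq[OF s])
  have "transpose W ** H1 x ** W = v x ** (?S ** (transpose (u x) ** H1 x ** u x) ** ?S) ** transpose (v x)"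
    unfolding W by (simp add: matrix_transpose_mul transpose_diag matrix_mul_assoc)
  then have 1: "transpose W ** H1 x ** W = v x ** ?e1 ** transpose (v x)"
    by (simp only: ou(2) SeS)
  have "v x ** ?e2 ** transpose (v x) = (v x ** transpose (v x)) ** H2 x ** (v x ** transpose (v x))"
    unfolding ov(2)[symmetric] by (simp add: matrix_mul_assoc)
  then have "H2 x = v x ** ?e2 ** transpose (v x)" by (simp add: vv)
  with 1 have "H2 x - transpose W ** H1 x ** W = v x ** (?e2 - ?e1) ** transpose (v x)"
    by (simp add: matrix_mult_diff_left matrix_mult_diff_right)
  then have "norm (H2 x - transpose W ** H1 x ** W) = norm (?e2 - ?e1)"
    by (simp add: norm_orthogonal_mult_left norm_orthogonal_mult_right ov orthogonal_matrix_transpose_self)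
  also have "\<dots> \<le> real CARD('n) * d"
    by (rule norm_le_if_entries_le) (use ev \<open>0 \<le> d\<close> in \<open>auto simp: diag_matrix_def abs_minus_commute\<close>)
  finally show "norm (H2 x - transpose W ** H1 x ** W) \<le> real CARD('n) * d" .
qed

lemma intertwiner_exists:
  fixes H1 H2 :: "real^'m \<Rightarrow> ('n::{finite,linorder}) sq_matrix"
  assumes u: "coupling_frame H1 A1 x U u" and v: "coupling_frame H2 A2 x V v"
    and T: "is_spanning_tree T (interaction_edges (A1 x))"
    and \<kappa>: "0 < \<kappa>" "\<kappa> \<le> 1" "\<And>m n. {m, n} \<in> T \<Longrightarrow> \<kappa> \<le> \<bar>A1 x (l {m, n}) $ m $ n\<bar>"
    and b: "0 \<le> b" "\<And>\<mu>. norm (A1 x \<mu>) \<le> b" and d: "0 \<le> d" "d \<le> 1"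
    and inv: "\<And>i. i \<in> invariant_indices (interaction_edges (A1 x)) T l \<Longrightarrow>
      \<bar>invariant_map T l (H1 x) (A1 x) i - invariant_map T l (H2 x) (A2 x) i\<bar> \<le> d"
  shows "\<exists>W. intertwines H1 A1 H2 A2 (gauge_const CARD('n) \<kappa> (b + 1) * d) x W"
proof -
  have tree: "graph_connected T" "graph_acyclic T" "T \<subseteq> interaction_edges (A1 x)"
    using T unfolding is_spanning_tree_def by auto
  have noloop: "{m, m} \<notin> T" for m
    using tree(3) unfolding interaction_edges_def by (auto simp: doubleton_eq_iff)
  have bound: "\<bar>A1 x \<mu> $ m $ n\<bar> \<le> (b + 1) - 1" for \<mu> m n
    using entry_le_norm[of "A1 x \<mu>" m n] b(2)[of \<mu>] by linarith
  have pure: "\<bar>(A1 x \<mu> $ m $ n)\<^sup>2 - (A2 x \<mu> $ m $ n)\<^sup>2\<bar> \<le> d" if "m < n" for \<mu> m n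
    using inv[of "Pure_Loop m n \<mu>"] that by (simp add: invariant_indices_def)
  have mixed: "\<bar>A1 x (l {m, n}) $ m $ n * A1 x \<mu> $ m $ n - A2 x (l {m, n}) $ m $ n * A2 x \<mu> $ m $ n\<bar> \<le> d"
    if "m < n" "{m, n} \<in> T" "\<mu> \<noteq> l {m, n}" for \<mu> m n
    using inv[of "Mixed_Loop m n \<mu>"] that tree(3) by (auto simp: invariant_indices_def)
  have cycles: "\<bar>edge_product (\<lambda>m n. A1 x (l {m, n}) $ m $ n) (tree_path T p q) * A1 x \<mu> $ q $ p
        - edge_product (\<lambda>m n. A2 x (l {m, n}) $ m $ n) (tree_path T p q) * A2 x \<mu> $ q $ p\<bar> \<le> d"
    if "p < q" "{p, q} \<notin> T" for \<mu> p q
    using inv[of "Cycle_Product p q \<mu>"] that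
    by (simp add: invariant_indices_def Let_def
        edge_product_eq_prod[of "\<lambda>m n. A1 x (l {m, n}) $ m $ n", simplified]
        edge_product_eq_prod[of "\<lambda>m n. A2 x (l {m, n}) $ m $ n", simplified])
  have b1: "1 \<le> b + 1" using b(1) by simp
  show ?thesis
  proof (rule couplings_close_up_to_signs[where a = "A1 x" and b = "A2 x" and l = l, OF tree(1,2) noloop
        coupling_frame_skew[OF u] coupling_frame_skew[OF v] \<kappa> b1 bound d pure mixed cycles])
    fix s
    assume "sign_vector s" "\<And>\<mu> m n. \<bar>A1 x \<mu> $ m $ n - s $ m * A2 x \<mu> $ m $ n * s $ n\<bar>
      \<le> gauge_const CARD('n) \<kappa> (b + 1) * d"
    then show ?thesis unfolding intertwines_def using u v by blast
  qed
qed

text \<open>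
  At \<open>x\<close>, the matrix \<open>W x\<close> conjugates \<open>H1 x\<close> to \<open>H2 x\<close> up to the eigenvalue error, and along a path
  from \<open>x0\<close> to \<open>x\<close> it differs from \<open>\<plusminus>W x0\<close> by at most \<open>L\<close> times its Lipschitz constant.  The local
  Lipschitz estimate has an arbitrarily small slack \<open>\<epsilon>\<close>, absorbed by the final \<open>e\<close>.
\<close>
lemma conjugation_bound:
  fixes H1 H2 :: "real^'m \<Rightarrow> ('n::{finite,linorder}) sq_matrix"
  assumes W: "\<And>x. x \<in> K \<Longrightarrow> intertwines H1 A1 H2 A2 \<eta> x (W x)"
    and T: "\<And>x. x \<in> K \<Longrightarrow> graph_connected (T x)"
      "\<And>x m n. x \<in> K \<Longrightarrow> {m, n} \<in> T x \<Longrightarrow> \<exists>\<mu>. \<kappa> \<le> \<bar>A1 x \<mu> $ m $ n\<bar>"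
    and \<eta>: "0 \<le> \<eta>" "\<eta> < \<kappa>" and L: "path_length_bound K (ennreal L)" "0 \<le> L"
    and ev: "\<And>x i. x \<in> K \<Longrightarrow>
      \<bar>ordered_eigenvalues (H1 x) $ i - ordered_eigenvalues (H2 x) $ i\<bar> \<le> d" and "0 \<le> d"
    and b: "\<And>x. x \<in> K \<Longrightarrow> norm (H1 x) \<le> b" and x: "x0 \<in> K" "x \<in> K"
  shows "norm (H2 x - transpose (W x0) ** H1 x ** W x0)
    \<le> real CARD('n) * d + 2 * b * (real CARD('m) * (real CARD('n) * \<eta>) * L)"
proof (rule field_le_epsilon)
  let ?c = "real CARD('m) * (real CARD('n) * \<eta>)"
  fix e :: real assume "0 < e"
  have "0 \<le> b" using b[OF x(1)] norm_ge_zero order_trans by blast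
  define \<epsilon> where "\<epsilon> = e / (2 * b * L + 1)"
  have den: "0 < 2 * b * L + 1" using \<open>0 \<le> b\<close> L(2) by (simp add: add_nonneg_pos)
  have \<epsilon>: "0 < \<epsilon>" using \<open>0 < e\<close> den by (simp add: \<epsilon>_def)
  have "2 * b * L * \<epsilon> \<le> (2 * b * L + 1) * \<epsilon>" using \<epsilon> by (intro mult_right_mono) auto
  also have "\<dots> = e" using den by (simp add: \<epsilon>_def)
  finally have e: "2 * b * L * \<epsilon> \<le> e" .
  obtain \<gamma> where \<gamma>: "path \<gamma>" "path_image \<gamma> \<subseteq> K" "pathstart \<gamma> = x0" "pathfinish \<gamma> = x"
    "path_length \<gamma> \<le> ennreal L"
    using L(1) x unfolding path_length_bound_def by blast
  have "\<exists>\<tau>. (\<tau> = 1 \<or> \<tau> = - 1) \<and> norm (W (pathfinish \<gamma>) - \<tau> *\<^sub>R W (pathstart \<gamma>)) \<le> (?c + \<epsilon>) * L"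
  proof (rule lipschitz_up_to_sign_along_path[OF \<gamma>(1,2,5) L(2)])
    show "0 \<le> ?c + \<epsilon>" using \<eta>(1) \<epsilon> by simp
    show "\<exists>\<delta>>0. \<forall>z\<in>K. dist z y < \<delta> \<longrightarrow>
        (\<exists>\<tau>. (\<tau> = 1 \<or> \<tau> = - 1) \<and> norm (W z - \<tau> *\<^sub>R W y) \<le> (?c + \<epsilon>) * dist z y)" if "y \<in> K" for y
      using intertwiner_locally_lipschitz[OF W[OF that] T(1)[OF that] T(2)[OF that] \<eta>(2) \<epsilon>] W by metis
  qed
  then obtain \<tau> where \<tau>: "\<tau> = 1 \<or> \<tau> = - 1" "norm (W x - \<tau> *\<^sub>R W x0) \<le> (?c + \<epsilon>) * L"
    unfolding \<gamma>(3,4) by blast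
  have orth: "orthogonal_matrix (W y)" if "y \<in> K" for y
    using intertwiner_conjugates(1)[OF W[OF that] ev[OF that] \<open>0 \<le> d\<close>] .
  have "norm (transpose (W x) ** H1 x ** W x - transpose (W x0) ** H1 x ** W x0)
      \<le> 2 * norm (H1 x) * norm (W x - \<tau> *\<^sub>R W x0)"
    by (rule conjugation_diff_le[OF orth[OF x(2)] orth[OF x(1)] \<tau>(1)])
  also have "\<dots> \<le> 2 * b * ((?c + \<epsilon>) * L)"
    using b[OF x(2)] \<tau>(2) \<open>0 \<le> b\<close> by (intro mult_mono) auto
  also have "\<dots> \<le> 2 * b * (?c * L) + e" using e by (simp add: algebra_simps)
  finally have "norm (transpose (W x) ** H1 x ** W x - transpose (W x0) ** H1 x ** W x0)
      \<le> 2 * b * (?c * L) + e" .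
  moreover have "norm (H2 x - transpose (W x) ** H1 x ** W x) \<le> real CARD('n) * d"
    using intertwiner_conjugates(2)[OF W[OF x(2)] ev[OF x(2)] \<open>0 \<le> d\<close>] .
  moreover have "norm (H2 x - transpose (W x0) ** H1 x ** W x0)
      \<le> norm (H2 x - transpose (W x) ** H1 x ** W x)
        + norm (transpose (W x) ** H1 x ** W x - transpose (W x0) ** H1 x ** W x0)"
    by (metis dist_norm dist_triangle)
  ultimately show "norm (H2 x - transpose (W x0) ** H1 x ** W x0)
      \<le> real CARD('n) * d + 2 * b * (?c * L) + e" by linarith
qed

theorem theorem3p1:
  fixes g B L :: ennreal and \<kappa> :: real
  assumes "0 < \<kappa>" and "L < \<infinity>"
  shows "\<exists>C \<delta>\<^sub>0 :: real. 0 < C \<and> 0 < \<delta>\<^sub>0 \<and>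
    (\<forall>(X :: (real^'m) set) (H1 :: real^'m \<Rightarrow> ('n::{finite,linorder}) sq_matrix) A1 K T l.
       open X \<and> connected X \<and>
       C1_symmetric_family X H1 \<and> nondegenerate_on X H1 \<and> derivative_coupling X H1 A1 \<and>
       (\<forall>x\<in>X. graph_connected (interaction_edges (A1 x))) \<and>
       compact K \<and> K \<subseteq> X \<and> path_length_bound K L \<and>
       (\<forall>x\<in>X. is_spanning_tree (T x) (interaction_edges (A1 x))) \<and>
       admissible_labels X A1 l \<and>
       (\<forall>x\<in>K. \<forall>m n. {m, n} \<in> T x \<longrightarrow> \<kappa> \<le> \<bar>A1 x (l x {m, n}) $ m $ n\<bar>) \<and>
       gap_modulus K H1 = g \<and> bound_modulus K H1 A1 = B \<longrightarrow>
       (\<forall>H2 A2.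
          C1_symmetric_family X H2 \<and> derivative_coupling X H2 A2 \<and>
          invariant_dist K T l H1 A1 H2 A2 \<le> ennreal \<delta>\<^sub>0 \<longrightarrow>
          conjugation_dist K H1 H2 \<le> ennreal C * invariant_dist K T l H1 A1 H2 A2))"
proof -
  \<comment> \<open>Cutting the lower bound down to at most one makes its powers decrease with the length of a path.\<close>
  define k where "k = min \<kappa> 1"
  define b where "b = enn2real B"
  define r where "r = enn2real L"
  define c where "c = gauge_const CARD('n) k (b + 1)"
  define C where "C = real CARD('n) + 2 * b * (real CARD('m) * (real CARD('n) * c) * r)"
  \<comment> \<open>The coupling error \<open>c d\<close> must stay below \<open>k\<close> for the signs to be rigid.\<close>
  define \<delta> where "\<delta> = min 1 (k / (2 * c))"
  have k: "0 < k" "k \<le> 1" "k \<le> \<kappa>" using assms(1) by (auto simp: k_def)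
  have b: "0 \<le> b" and r: "0 \<le> r" "L = ennreal r" using assms(2) by (auto simp: b_def r_def less_top)
  have c: "0 < c" unfolding c_def using k b by (intro gauge_const_pos) auto
  have "0 < C" unfolding C_def using b r c by (intro add_pos_nonneg) auto
  have "0 < \<delta>" using k c by (simp add: \<delta>_def)
  have main: "conjugation_dist K H1 H2 \<le> ennreal C * invariant_dist K T l H1 A1 H2 A2"
    if X: "open X" "C1_symmetric_family X H1" "nondegenerate_on X H1" "derivative_coupling X H1 A1"
      and K: "compact K" "K \<subseteq> X" "path_length_bound K L"
      and T: "\<forall>x\<in>X. is_spanning_tree (T x) (interaction_edges (A1 x))"
        "\<forall>x\<in>K. \<forall>m n. {m, n} \<in> T x \<longrightarrow> \<kappa> \<le> \<bar>A1 x (l x {m, n}) $ m $ n\<bar>"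
      and B: "bound_modulus K H1 A1 = B"
      and H2: "derivative_coupling X H2 A2" "invariant_dist K T l H1 A1 H2 A2 \<le> ennreal \<delta>"
    for X :: "(real^'m) set" and H1 :: "real^'m \<Rightarrow> 'n sq_matrix" and A1 K T l H2 A2
  proof (cases "K = {}")
    case True
    have "conjugation_dist K H1 H2 \<le> 0"
      unfolding conjugation_dist_def by (rule INF_lower2[of "mat 1"]) (auto simp: True orthogonal_matrix bot_ennreal)
    then show ?thesis by simp
  next
    case False
    then obtain x0 where x0: "x0 \<in> K" by blast
    define D where "D = invariant_dist K T l H1 A1 H2 A2"
    define d where "d = enn2real D"
    have "D < \<infinity>" using H2(2) unfolding D_def[symmetric] by (rule le_less_trans) simp
    then have d: "0 \<le> d" "D = ennreal d" by (auto simp: d_def less_top)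
    then have d\<delta>: "d \<le> \<delta>" using H2(2) \<open>0 < \<delta>\<close> by (simp add: D_def[symmetric])
    have nd: "nondegenerate_on K H2"
      using \<open>D < \<infinity>\<close> unfolding D_def invariant_dist_def by (auto split: if_splits)
    have inv: "\<bar>invariant_map (T x) (l x) (H1 x) (A1 x) i - invariant_map (T x) (l x) (H2 x) (A2 x) i\<bar> \<le> d"
      if "x \<in> K" "i \<in> invariant_indices (interaction_edges (A1 x)) (T x) (l x)" for x i
    proof -
      have "ennreal \<bar>invariant_map (T x) (l x) (H1 x) (A1 x) i - invariant_map (T x) (l x) (H2 x) (A2 x) i\<bar> \<le> D"
        unfolding D_def invariant_dist_def if_P[OF nd]
        by (rule SUP_upper2[OF that(1)], rule SUP_upper2[OF that(2)]) simp
      then show ?thesis using d by simp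
    qed
    have ev: "\<bar>ordered_eigenvalues (H1 x) $ i - ordered_eigenvalues (H2 x) $ i\<bar> \<le> d" if "x \<in> K" for x i
      using inv[OF that, of "Eigenvalue i"] by (simp add: invariant_indices_def)
    \<comment> \<open>The constants use the real value of \<open>B\<close>, which is meaningful since \<open>K\<close> is compact.\<close>
    have "B < \<infinity>" using bound_modulus_finite[OF X(2,3,4,1) K(1,2)] B by simp
    note bounds = bound_modulus_le[OF B this, folded b_def]
    have "\<exists>W. intertwines H1 A1 H2 A2 (c * d) x W" if x: "x \<in> K" for x
    proof -
      have "x \<in> X" using x K by auto
      obtain U u where u: "coupling_frame H1 A1 x U u"
        using derivative_coupling_frame[OF X(4) \<open>x \<in> X\<close>] X(3) \<open>x \<in> X\<close> unfolding nondegenerate_on_def by metis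
      obtain V v where v: "coupling_frame H2 A2 x V v"
        using derivative_coupling_frame[OF H2(1) \<open>x \<in> X\<close>] nd x unfolding nondegenerate_on_def by metis
      have "k \<le> \<bar>A1 x (l x {m, n}) $ m $ n\<bar>" if "{m, n} \<in> T x" for m n
        using T(2) x that k(3) order_trans by blast
      moreover have "d \<le> 1" using d\<delta> by (simp add: \<delta>_def)
      ultimately show ?thesis
        using intertwiner_exists[OF u v _ k(1,2) _ b bounds(2)[OF x] d(1) _ inv[OF x]] T(1) \<open>x \<in> X\<close>
        unfolding c_def by blast
    qed
    then obtain W where W: "\<And>x. x \<in> K \<Longrightarrow> intertwines H1 A1 H2 A2 (c * d) x (W x)" by metis
    have "c * d \<le> c * (k / (2 * c))" using d\<delta> c by (intro mult_left_mono) (auto simp: \<delta>_def)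
    then have small: "c * d < k" using c k by simp
    have conn: "graph_connected (T x)" if "x \<in> K" for x
      using T(1) K(2) that unfolding is_spanning_tree_def by blast
    have edge: "\<exists>\<mu>. k \<le> \<bar>A1 x \<mu> $ m $ n\<bar>" if "x \<in> K" "{m, n} \<in> T x" for x m n
      using T(2) that k(3) order_trans by blast
    have "norm (H2 x - transpose (W x0) ** H1 x ** W x0) \<le> C * d" if "x \<in> K" for x
    proof -
      have "norm (H2 x - transpose (W x0) ** H1 x ** W x0)
          \<le> real CARD('n) * d + 2 * b * (real CARD('m) * (real CARD('n) * (c * d)) * r)"
        by (rule conjugation_bound[where T = T and \<kappa> = k, OF W conn edge _ small _ r(1) ev d(1) bounds(1) x0 that])
          (use c d K(3) r in auto)
      then show ?thesis by (simp add: C_def algebra_simps)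
    qed
    then have "(SUP x\<in>K. ennreal (norm (H2 x - transpose (W x0) ** H1 x ** W x0))) \<le> ennreal (C * d)"
      by (intro SUP_least ennreal_leI) auto
    moreover have "orthogonal_matrix (W x0)"
      using intertwiner_conjugates(1)[OF W[OF x0] ev[OF x0] d(1)] .
    ultimately have "conjugation_dist K H1 H2 \<le> ennreal (C * d)"
      unfolding conjugation_dist_def by (intro INF_lower2[of "W x0"]) auto
    also have "\<dots> = ennreal C * D" using d \<open>0 < C\<close> by (simp add: ennreal_mult)
    finally show ?thesis by (simp add: D_def)
  qed
  show ?thesis
    by (intro exI[of _ C] exI[of _ \<delta>] conjI allI impI; (elim conjE)?;
        (rule \<open>0 < C\<close> | rule \<open>0 < \<delta>\<close> | rule main; assumption))
qed

end
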